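(* Let $\epsilon\in\{-1,1\}$ and let $f:M^m\to\mathbb{Q}_\epsilon^n\times\mathbb{R}$ be an isometric immersion. Let $\eta$ be the normal vector field defined by $\frac{\partial}{\partial t}=f_*T+\eta$. Assume that $L:=N_1+\mathrm{span}\{\eta\}$ is a subbundle of the normal bundle $N^fM$ of rank $\ell<n+1-m$. Then $\nabla^\perp N_1\subset L$ if and only if the following two conditions hold: (i) $\nabla^\perp R^\perp|_{L^\perp}=0$; (ii) $\nabla^\perp H\in L$.
   Context: $\mathbb{Q}_1^n=\mathbb{S}^n$, $\mathbb{Q}_{-1}^n=\mathbb{H}^n$. $\partial/\partial t$ is a unit vector field tangent to the factor $\mathbb{R}$ of $\mathbb{Q}_\epsilon^n\times\mathbb{R}$; $T$ is the tangent and $\eta$ the normal component of $\partial/\partial t$ along $f$. $N_1(x)$ is the first normal space of $f$ at $x$, i.e. the subspace of $N^f_xM$ spanned by the values of the second fundamental form at $x$. $\nabla^\perp$ is the normal connection, $R^\perp$ its curvature tensor, $H$ the mean curvature vector field of $f$, and $L^\perp$ the orthogonal complement of $L$ in $N^fM$. $\nabla^\perp N_1\subset L$ means $\nabla^\perp_X\xi\in L$ for every tangent $X$ and every local smooth normal section $\xi$ with values in $N_1$. Condition (i) means that for all tangent fields $X,Y,Z$ and all sections $\xi$ of $L^\perp$, $$\nabla^\perp_Z\big(R^\perp(X,Y)\xi\big)-R^\perp(\nabla_ZX,Y)\xi-R^\perp(X,\nabla_ZY)\xi-R^\perp(X,Y)\nabla^\perp_Z\xi=0,$$ and condition (ii)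 means $\nabla^\perp_XH\in L$ for all tangent $X$. *)

theory Defs
  imports "HOL-Analysis.Analysis"
begin

section \<open>Smooth maps and smooth manifolds\<close>

text \<open>Meant for open \<open>S\<close> only.\<close>

fun Ck_on :: "nat \<Rightarrow> 'a::euclidean_space set \<Rightarrow> ('a \<Rightarrow> 'b::real_normed_vector) \<Rightarrow> bool" where
  "Ck_on 0 S F \<longleftrightarrow> continuous_on S F"
| "Ck_on (Suc k) S F \<longleftrightarrow>
     F differentiable_on S \<and> (\<forall>v. Ck_on k S (\<lambda>x. frechet_derivative F (at x) v))"

definition smooth_on :: "'a::euclidean_space set \<Rightarrow> ('a \<Rightarrow> 'b::real_normed_vector) \<Rightarrow> bool" where
  "smooth_on S F \<longleftrightarrow> (\<forall>k. Ck_on k S F)"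

type_synonym ('p, 'd) chart = "'p set \<times> ('p \<Rightarrow> 'd)"
type_synonym ('p, 'd) atlas = "('p, 'd) chart set"

definition second_countable_space :: "'p topology \<Rightarrow> bool" where
  "second_countable_space M \<longleftrightarrow>
     (\<exists>B. countable B \<and> (\<forall>V\<in>B. openin M V) \<and>
          (\<forall>U p. openin M U \<and> p \<in> U \<longrightarrow> (\<exists>V\<in>B. p \<in> V \<and> V \<subseteq> U)))"

text \<open>The dimension of the manifold is \<open>DIM('d)\<close>.\<close>

definition smooth_manifold :: "'p topology \<Rightarrow> ('p, 'd::euclidean_space) atlas \<Rightarrow> bool" where
  "smooth_manifold M A \<longleftrightarrow>
     Hausdorff_space M \<and> second_countable_space M \<and>
     (\<Union>(V, \<phi>)\<in>A. V) = topspace M \<and>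
     (\<forall>(V, \<phi>)\<in>A. openin M V \<and> open (\<phi> ` V) \<and>
        homeomorphic_map (subtopology M V) (top_of_set (\<phi> ` V)) \<phi>) \<and>
     (\<forall>(V, \<phi>)\<in>A. \<forall>(W, \<psi>)\<in>A. smooth_on (\<phi> ` (V \<inter> W)) (\<psi> \<circ> inv_into V \<phi>))"

definition smooth_map ::
    "('p, 'd::euclidean_space) atlas \<Rightarrow> 'p set \<Rightarrow> ('p \<Rightarrow> 'b::real_normed_vector) \<Rightarrow> bool" where
  "smooth_map A U F \<longleftrightarrow> (\<forall>(V, \<phi>)\<in>A. smooth_on (\<phi> ` (U \<inter> V)) (F \<circ> inv_into V \<phi>))"

subsection \<open>Tangent vectors and vector fields\<close>

text \<open>
  A preferred chart is chosen around every point, and the tangent space at \<open>p\<close> is the whole of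
  \<open>'d\<close>: a vector is given by its coordinates in the preferred chart at \<open>p\<close>. A vector field is
  thus a function \<open>'p \<Rightarrow> 'd\<close>; since the preferred chart may jump from point to point, its
  smoothness is that of its coordinates in each fixed chart of the atlas.
\<close>

definition chart_at :: "('p, 'd) atlas \<Rightarrow> 'p \<Rightarrow> ('p, 'd) chart" where
  "chart_at A p = (SOME c. c \<in> A \<and> p \<in> fst c)"

text \<open>The differential at \<open>p\<close> of a vector-valued map, applied to the tangent vector \<open>v\<close>.\<close>

definition tdiff ::
    "('p, 'd::euclidean_space) atlas \<Rightarrow> ('p \<Rightarrow> 'b::real_normed_vector) \<Rightarrow> 'p \<Rightarrow> 'd \<Rightarrow> 'b" where
  "tdiff A F p v =
     (let (V, \<phi>) = chart_at A p in frechet_derivative (F \<circ> inv_into V \<phi>) (at (\<phi> p)) v)"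

text \<open>\<open>tdiff A \<phi> q (X q)\<close> is the coordinate vector of \<open>X q\<close> in the chart \<open>\<phi>\<close>.\<close>

definition smooth_field ::
    "('p, 'd::euclidean_space) atlas \<Rightarrow> 'p set \<Rightarrow> ('p \<Rightarrow> 'd) \<Rightarrow> bool" where
  "smooth_field A U X \<longleftrightarrow> (\<forall>(V, \<phi>)\<in>A. smooth_map A (U \<inter> V) (\<lambda>q. tdiff A \<phi> q (X q)))"

text \<open>\<open>[X,Y] = DY(X) - DX(Y)\<close>, computed in the preferred chart at \<open>p\<close>.\<close>

definition lie_bracket ::
    "('p, 'd::euclidean_space) atlas \<Rightarrow> ('p \<Rightarrow> 'd) \<Rightarrow> ('p \<Rightarrow> 'd) \<Rightarrow> 'p \<Rightarrow> 'd" where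
  "lie_bracket A X Y p =
     (let (V, \<phi>) = chart_at A p in
        tdiff A (\<lambda>q. tdiff A \<phi> q (Y q)) p (X p) - tdiff A (\<lambda>q. tdiff A \<phi> q (X q)) p (Y p))"

text \<open>The field that extends \<open>w\<close>, tangent at \<open>p\<close>, with constant coordinates in the preferred chart
  at \<open>p\<close> (meaningful on the domain of that chart).\<close>

definition const_field ::
    "('p, 'd::euclidean_space) atlas \<Rightarrow> 'p \<Rightarrow> 'd \<Rightarrow> 'p \<Rightarrow> 'd" where
  "const_field A p w q =
     (let (V, \<phi>) = chart_at A p; (W, \<psi>) = chart_at A q in
        frechet_derivative (\<psi> \<circ> inv_into V \<phi>) (at (\<phi> q)) w)"

subsection \<open>Riemannian metrics and the Levi-Civita connection\<close>

definition riemannian_metric ::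
    "'p topology \<Rightarrow> ('p, 'd::euclidean_space) atlas \<Rightarrow> ('p \<Rightarrow> 'd \<Rightarrow> 'd \<Rightarrow> real) \<Rightarrow> bool" where
  "riemannian_metric M A g \<longleftrightarrow>
     (\<forall>p\<in>topspace M. bilinear (g p) \<and> (\<forall>v w. g p v w = g p w v) \<and> (\<forall>v. v \<noteq> 0 \<longrightarrow> g p v v > 0)) \<and>
     (\<forall>U X Y. openin M U \<and> smooth_field A U X \<and> smooth_field A U Y \<longrightarrow>
        smooth_map A U (\<lambda>q. g q (X q) (Y q)))"

text \<open>An affine connection, acting on fields that are smooth on an open set. Fields are total
  functions, but on \<open>U\<close> only fields smooth on \<open>U\<close> are constrained.\<close>

definition affine_connection ::
    "'p topology \<Rightarrow> ('p, 'd::euclidean_space) atlas \<Rightarrow>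
      (('p \<Rightarrow> 'd) \<Rightarrow> ('p \<Rightarrow> 'd) \<Rightarrow> 'p \<Rightarrow> 'd) \<Rightarrow> bool" where
  "affine_connection M A nabla \<longleftrightarrow>
     (\<forall>U X Y Z h. openin M U \<and> smooth_field A U X \<and> smooth_field A U Y \<and> smooth_field A U Z \<and>
        smooth_map A U (h :: 'p \<Rightarrow> real) \<longrightarrow>
        smooth_field A U (nabla X Y) \<and>
        (\<forall>p\<in>U.
           nabla (\<lambda>q. X q + Y q) Z p = nabla X Z p + nabla Y Z p \<and>
           nabla (\<lambda>q. h q *\<^sub>R X q) Y p = h p *\<^sub>R nabla X Y p \<and>
           nabla X (\<lambda>q. Y q + Z q) p = nabla X Y p + nabla X Z p \<and>
           nabla X (\<lambda>q. h q *\<^sub>R Y q) p = tdiff A h p (X p) *\<^sub>R Y p + h p *\<^sub>R nabla X Y p))"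

definition levi_civita ::
    "'p topology \<Rightarrow> ('p, 'd::euclidean_space) atlas \<Rightarrow> ('p \<Rightarrow> 'd \<Rightarrow> 'd \<Rightarrow> real) \<Rightarrow>
      (('p \<Rightarrow> 'd) \<Rightarrow> ('p \<Rightarrow> 'd) \<Rightarrow> 'p \<Rightarrow> 'd) \<Rightarrow> bool" where
  "levi_civita M A g nabla \<longleftrightarrow> affine_connection M A nabla \<and>
     (\<forall>U X Y Z. openin M U \<and> smooth_field A U X \<and> smooth_field A U Y \<and> smooth_field A U Z \<longrightarrow>
        (\<forall>p\<in>U.
           nabla X Y p - nabla Y X p = lie_bracket A X Y p \<and>
           tdiff A (\<lambda>q. g q (Y q) (Z q)) p (X p) =
             g p (nabla X Y p) (Z p) + g p (Y p) (nabla X Z p)))"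

section \<open>The product of a space form with the line\<close>

text \<open>
  With \<open>n = DIM('e)\<close>, the quadric of curvature \<open>\<epsilon>\<close> lies in \<open>real \<times> 'e\<close> with the form
  \<open>\<epsilon> x0 y0 + x \<bullet> y\<close>: the unit sphere for \<open>\<epsilon> = 1\<close>, the hyperboloid model of hyperbolic space for
  \<open>\<epsilon> = -1\<close>. The last factor of \<open>'e ambient\<close> is the line \<open>\<real>\<close>.
\<close>

type_synonym 'e ambient = "(real \<times> 'e) \<times> real"

definition quadric :: "real \<Rightarrow> (real \<times> 'e::euclidean_space) set" where
  "quadric \<epsilon> = {(x0, x). \<epsilon> * x0\<^sup>2 + x \<bullet> x = \<epsilon> \<and> (\<epsilon> = -1 \<longrightarrow> x0 > 0)}"

fun ambient_form :: "real \<Rightarrow> 'e::euclidean_space ambient \<Rightarrow> 'e ambient \<Rightarrow> real" where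
  "ambient_form \<epsilon> ((x0, x), s) ((y0, y), t) = \<epsilon> * x0 * y0 + x \<bullet> y + s * t"

definition d_dt :: "'e::euclidean_space ambient" where
  "d_dt = ((0, 0), 1)"

text \<open>The normal line to \<open>quadric \<epsilon> \<times> UNIV\<close> at \<open>y = (q, t)\<close> is spanned by \<open>(q, 0)\<close>, on which
  \<open>ambient_form \<epsilon>\<close> takes the value \<open>\<epsilon> = 1 / \<epsilon>\<close>.\<close>

definition product_tangent_space ::
    "real \<Rightarrow> 'e::euclidean_space ambient \<Rightarrow> 'e ambient set" where
  "product_tangent_space \<epsilon> y = {w. ambient_form \<epsilon> w (fst y, 0) = 0}"

definition product_tangent_part ::
    "real \<Rightarrow> 'e::euclidean_space ambient \<Rightarrow> 'e ambient \<Rightarrow> 'e ambient" where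
  "product_tangent_part \<epsilon> y w = w - (\<epsilon> * ambient_form \<epsilon> w (fst y, 0)) *\<^sub>R (fst y, 0)"

section \<open>Isometric immersions\<close>

definition isometric_immersion ::
    "'p topology \<Rightarrow> ('p, 'd::euclidean_space) atlas \<Rightarrow> ('p \<Rightarrow> 'd \<Rightarrow> 'd \<Rightarrow> real) \<Rightarrow> real \<Rightarrow>
      ('p \<Rightarrow> 'e::euclidean_space ambient) \<Rightarrow> bool" where
  "isometric_immersion M A g \<epsilon> f \<longleftrightarrow>
     smooth_map A (topspace M) f \<and>
     (\<forall>p\<in>topspace M. f p \<in> quadric \<epsilon> \<times> UNIV \<and> inj (tdiff A f p) \<and>
        (\<forall>v w. ambient_form \<epsilon> (tdiff A f p v) (tdiff A f p w) = g p v w))"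

definition normal_space_at ::
    "('p, 'd::euclidean_space) atlas \<Rightarrow> real \<Rightarrow> ('p \<Rightarrow> 'e::euclidean_space ambient) \<Rightarrow>
      'p \<Rightarrow> 'e ambient set" where
  "normal_space_at A \<epsilon> f p =
     {w \<in> product_tangent_space \<epsilon> (f p). \<forall>v. ambient_form \<epsilon> w (tdiff A f p v) = 0}"

definition normal_part ::
    "('p, 'd::euclidean_space) atlas \<Rightarrow> real \<Rightarrow> ('p \<Rightarrow> 'e::euclidean_space ambient) \<Rightarrow>
      'p \<Rightarrow> 'e ambient \<Rightarrow> 'e ambient" where
  "normal_part A \<epsilon> f p z = (THE w. w \<in> normal_space_at A \<epsilon> f p \<and> z - w \<in> range (tdiff A f p))"

text \<open>The Levi-Civita connection of \<open>quadric \<epsilon> \<times> UNIV\<close>, acting on fields \<open>W\<close> along \<open>f\<close> tangent to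
  it: the tangential part of the flat derivative.\<close>

definition ambient_connection ::
    "('p, 'd::euclidean_space) atlas \<Rightarrow> real \<Rightarrow> ('p \<Rightarrow> 'e::euclidean_space ambient) \<Rightarrow>
      'p \<Rightarrow> 'd \<Rightarrow> ('p \<Rightarrow> 'e ambient) \<Rightarrow> 'e ambient" where
  "ambient_connection A \<epsilon> f p v W = product_tangent_part \<epsilon> (f p) (tdiff A W p v)"

definition normal_connection ::
    "('p, 'd::euclidean_space) atlas \<Rightarrow> real \<Rightarrow> ('p \<Rightarrow> 'e::euclidean_space ambient) \<Rightarrow>
      'p \<Rightarrow> 'd \<Rightarrow> ('p \<Rightarrow> 'e ambient) \<Rightarrow> 'e ambient" where
  "normal_connection A \<epsilon> f p v \<xi> = normal_part A \<epsilon> f p (ambient_connection A \<epsilon> f p v \<xi>)"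

text \<open>\<open>\<alpha>(X,Y)\<close> is the normal part of the derivative of \<open>f\<^sub>*Y\<close> in the direction \<open>X\<close>. It is tensorial,
  so its value on two vectors at \<open>p\<close> may be computed with any extension of the second one.\<close>

definition second_fundamental_form ::
    "('p, 'd::euclidean_space) atlas \<Rightarrow> real \<Rightarrow> ('p \<Rightarrow> 'e::euclidean_space ambient) \<Rightarrow>
      'p \<Rightarrow> 'd \<Rightarrow> 'd \<Rightarrow> 'e ambient" where
  "second_fundamental_form A \<epsilon> f p v w =
     normal_part A \<epsilon> f p
       (ambient_connection A \<epsilon> f p v (\<lambda>q. tdiff A f q (const_field A p w q)))"

definition first_normal_space ::
    "('p, 'd::euclidean_space) atlas \<Rightarrow> real \<Rightarrow> ('p \<Rightarrow> 'e::euclidean_space ambient) \<Rightarrow>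
      'p \<Rightarrow> 'e ambient set" where
  "first_normal_space A \<epsilon> f p = span {second_fundamental_form A \<epsilon> f p v w | v w. True}"

definition orthonormal_basis :: "('d::euclidean_space \<Rightarrow> 'd \<Rightarrow> real) \<Rightarrow> 'd set \<Rightarrow> bool" where
  "orthonormal_basis h B \<longleftrightarrow>
     finite B \<and> card B = DIM('d) \<and> (\<forall>a\<in>B. \<forall>b\<in>B. h a b = (if a = b then 1 else 0))"

text \<open>The trace does not depend on the orthonormal basis chosen.\<close>

definition mean_curvature ::
    "('p, 'd::euclidean_space) atlas \<Rightarrow> ('p \<Rightarrow> 'd \<Rightarrow> 'd \<Rightarrow> real) \<Rightarrow> real \<Rightarrow>
      ('p \<Rightarrow> 'e::euclidean_space ambient) \<Rightarrow> 'p \<Rightarrow> 'e ambient" where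
  "mean_curvature A g \<epsilon> f p =
     (1 / real DIM('d)) *\<^sub>R
       (\<Sum>b\<in>(SOME B. orthonormal_basis (g p) B). second_fundamental_form A \<epsilon> f p b b)"

definition normal_curvature ::
    "('p, 'd::euclidean_space) atlas \<Rightarrow> real \<Rightarrow> ('p \<Rightarrow> 'e::euclidean_space ambient) \<Rightarrow>
      ('p \<Rightarrow> 'd) \<Rightarrow> ('p \<Rightarrow> 'd) \<Rightarrow> ('p \<Rightarrow> 'e ambient) \<Rightarrow> 'p \<Rightarrow> 'e ambient" where
  "normal_curvature A \<epsilon> f X Y \<xi> p =
     normal_connection A \<epsilon> f p (X p) (\<lambda>q. normal_connection A \<epsilon> f q (Y q) \<xi>)
     - normal_connection A \<epsilon> f p (Y p) (\<lambda>q. normal_connection A \<epsilon> f q (X q) \<xi>)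
     - normal_connection A \<epsilon> f p (lie_bracket A X Y p) \<xi>"

text \<open>Smooth local section on \<open>U\<close> of a family \<open>E\<close> of subspaces of the normal spaces.\<close>

definition smooth_section ::
    "('p, 'd::euclidean_space) atlas \<Rightarrow> 'p set \<Rightarrow> ('p \<Rightarrow> 'e::euclidean_space ambient set) \<Rightarrow>
      ('p \<Rightarrow> 'e ambient) \<Rightarrow> bool" where
  "smooth_section A U E \<xi> \<longleftrightarrow> smooth_map A U \<xi> \<and> (\<forall>q\<in>U. \<xi> q \<in> E q)"

text \<open>A family \<open>E\<close> of subspaces is a smooth subbundle of rank \<open>r\<close> of the normal bundle if it is
  locally spanned by \<open>r\<close> smooth, pointwise linearly independent sections.\<close>

definition normal_subbundle ::
    "'p topology \<Rightarrow> ('p, 'd::euclidean_space) atlas \<Rightarrow> real \<Rightarrow>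
      ('p \<Rightarrow> 'e::euclidean_space ambient) \<Rightarrow> ('p \<Rightarrow> 'e ambient set) \<Rightarrow> nat \<Rightarrow> bool" where
  "normal_subbundle M A \<epsilon> f E r \<longleftrightarrow>
     (\<forall>p\<in>topspace M. E p \<subseteq> normal_space_at A \<epsilon> f p) \<and>
     (\<forall>p\<in>topspace M. \<exists>U s. openin M U \<and> p \<in> U \<and>
        (\<forall>i<r. smooth_section A U E (s i)) \<and>
        (\<forall>q\<in>U. inj_on (\<lambda>i::nat. s i q) {..<r} \<and> independent ((\<lambda>i. s i q) ` {..<r}) \<and>
           E q = span ((\<lambda>i. s i q) ` {..<r})))"

definition normal_complement ::
    "('p, 'd::euclidean_space) atlas \<Rightarrow> real \<Rightarrow> ('p \<Rightarrow> 'e::euclidean_space ambient) \<Rightarrow>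
      ('p \<Rightarrow> 'e ambient set) \<Rightarrow> 'p \<Rightarrow> 'e ambient set" where
  "normal_complement A \<epsilon> f E p =
     {w \<in> normal_space_at A \<epsilon> f p. \<forall>x\<in>E p. ambient_form \<epsilon> w x = 0}"

end

theory Submission
  imports Defs
begin

text \<open>
  Everything is expressed through the flat derivative \<open>D\<close> of maps into the ambient vector space. For
  a section \<open>\<xi>\<close> of \<open>L\<^sup>\<bottom>\<close>, which is orthogonal to the second fundamental form \<open>\<alpha>\<close> and to
  \<open>\<partial>/\<partial>t\<close>, the derivative \<open>D\<^sub>v \<xi>\<close> is again normal and orthogonal to \<open>\<eta>\<close>. Thus it is
  the normal covariant derivative of \<open>\<xi>\<close>, and the normal curvature vanishes on \<open>L\<^sup>\<bottom>\<close> because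
  flat derivatives commute. So condition (i) only says that the curvature also annihilates
  \<open>D\<^sub>v \<xi>\<close>, and by duality \<open>D N\<^sub>1 \<subseteq> L\<close> (modulo tangent vectors) is equivalent to the
  parallelism of \<open>L\<^sup>\<bottom>\<close>, which gives the direct implication.

  For the converse, let \<open>C\<^sub>v\<close> be the shape operator of \<open>D\<^sub>v \<xi>\<close> at a point. The form
  \<open>\<langle>C\<^sub>v x, y\<rangle>\<close> is totally symmetric by the Codazzi equation, the operators \<open>C\<^sub>v\<close> commute by (i)
  and the Ricci equation, and they are traceless by (ii). Hence \<open>x \<cdot> y = C\<^sub>x y\<close> is a commutative
  and associative product, so that \<open>tr C\<^sub>v\<^sup>2 = tr C\<^bsub>v \<cdot> v\<^esub> = 0\<close> and \<open>C\<^sub>v = 0\<close> for all \<open>v\<close>: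
  this is the parallelism of \<open>L\<^sup>\<bottom>\<close>.
\<close>

section \<open>Calculus of smooth maps on open sets\<close>

text \<open>Adding \<open>\<eta>\<close> to the first normal space deals with the curvature of the
  quadric. In the flat ambient space the derivative of a normal section \<open>\<xi>\<close> also
  has a component along the position vector, proportional to the pairing of \<open>\<xi>\<close>
  with the quadric part of \<open>f_* v\<close>. That part is \<open>f_* v\<close> minus a multiple
  of \<open>d_dt\<close>, so the component vanishes once \<open>\<xi>\<close> is orthogonal to
  \<open>\<eta>\<close>. As \<open>D_v \<xi>\<close> stays orthogonal to \<open>\<eta>\<close>,
  second derivatives have no position component either, even before \<open>D_v \<xi>\<close> is
  known to lie in the complement of \<open>L\<close>. Two obstacles shape the preparation. The
  ambient form is Lorentzian for \<epsilon> = -1, so orthogonal projections are made only onto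
  spaces where it is positive. And only \<open>L\<close> comes with a smooth frame, while
  \<open>N1\<close> may change rank and \<open>mean_curvature\<close> is a trace over a basis chosen
  point by point. Sections of \<open>N1\<close> are therefore produced as values of the second
  fundamental form on coordinate fields, and smoothness of the mean curvature is proved by passing
  to a smooth frame.\<close>

lemma frechet_derivative_worksI:
  "F differentiable net \<Longrightarrow> (F has_derivative frechet_derivative F net) net"
  by (simp add: frechet_derivative_works)

lemma Ck_on_cong:
  assumes "open S" "\<And>x. x \<in> S \<Longrightarrow> F x = G x"
  shows "Ck_on k S F \<longleftrightarrow> Ck_on k S G"
  using assms(2)
proof (induction k arbitrary: F G)
  case 0
  then show ?case by (auto intro: continuous_on_cong)
next
  case (Suc k)
  have "F differentiable_on S \<longleftrightarrow> G differentiable_on S"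
    using Suc.prems unfolding differentiable_on_def differentiable_def
    by (metis (no_types, lifting) has_derivative_transform)
  moreover have "Ck_on k S (\<lambda>x. frechet_derivative F (at x) v)
      \<longleftrightarrow> Ck_on k S (\<lambda>x. frechet_derivative G (at x) v)"
    if diff: "F differentiable_on S" for v
  proof (rule Suc.IH)
    fix x assume "x \<in> S"
    then have "F differentiable (at x)"
      using diff assms(1) by (metis at_within_open differentiable_on_def)
    with \<open>x \<in> S\<close> show "frechet_derivative F (at x) v = frechet_derivative G (at x) v"
      using frechet_derivative_transform_within_open[OF _ assms(1), of F x G] Suc.prems by metis
  qed
  ultimately show ?case by auto
qed

lemma Ck_on_differentiable:
  assumes "open S" "Ck_on (Suc k) S F" "x \<in> S"
  shows "F differentiable (at x)"
  using assms by (metis Ck_on.simps(2) at_within_open differentiable_on_def)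

lemma Ck_on_Suc_imp: "Ck_on (Suc k) S F \<Longrightarrow> Ck_on k S F"
proof (induction k arbitrary: F)
  case 0
  then show ?case by (auto intro: differentiable_imp_continuous_on)
next
  case (Suc k)
  then show ?case by (metis Ck_on.simps(2))
qed

lemma Ck_on_subset: "Ck_on k S F \<Longrightarrow> T \<subseteq> S \<Longrightarrow> Ck_on k T F"
  by (induction k arbitrary: F) (auto intro: continuous_on_subset differentiable_on_subset)

lemma Ck_on_local:
  assumes "\<And>x. x \<in> S \<Longrightarrow> \<exists>T. open T \<and> x \<in> T \<and> Ck_on k T F"
  shows "Ck_on k S F"
  using assms
proof (induction k arbitrary: F)
  case 0
  show ?case unfolding Ck_on.simps
  proof (intro continuous_at_imp_continuous_on ballI)
    fix x assume "x \<in> S"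
    with 0 show "isCont F x" by (metis Ck_on.simps(1) continuous_on_eq_continuous_at)
  qed
next
  case (Suc k)
  have "F differentiable_on S" unfolding differentiable_on_def
  proof
    fix x assume "x \<in> S"
    with Suc.prems obtain T where "open T" "x \<in> T" "Ck_on (Suc k) T F" by blast
    then show "F differentiable (at x within S)"
      using Ck_on_differentiable differentiable_at_withinI by blast
  qed
  moreover have "Ck_on k S (\<lambda>x. frechet_derivative F (at x) v)" for v
    using Suc.prems by (intro Suc.IH) (metis Ck_on.simps(2))
  ultimately show ?case by simp
qed

lemma Ck_on_const: "Ck_on k S (\<lambda>x. c)"
  by (induction k arbitrary: c) auto

lemma Ck_on_add:
  assumes "open S" "Ck_on k S F" "Ck_on k S G"
  shows "Ck_on k S (\<lambda>x. F x + G x)"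
  using assms(2,3)
proof (induction k arbitrary: F G)
  case 0
  then show ?case by (auto intro: continuous_on_add)
next
  case (Suc k)
  have "frechet_derivative (\<lambda>x. F x + G x) (at x) v
      = frechet_derivative F (at x) v + frechet_derivative G (at x) v" if "x \<in> S" for x v
    using Ck_on_differentiable[OF assms(1) _ that] Suc.prems
    by (intro fun_cong[OF frechet_derivative_at[symmetric]] has_derivative_add
        frechet_derivative_worksI) auto
  then have "Ck_on k S (\<lambda>x. frechet_derivative (\<lambda>x. F x + G x) (at x) v)" for v
    using Suc by (subst Ck_on_cong[OF assms(1)]) auto
  with Suc.prems show ?case by (auto intro: differentiable_on_add)
qed

lemma Ck_on_sum:
  assumes "open S" "\<And>i. i \<in> I \<Longrightarrow> Ck_on k S (F i)"
  shows "Ck_on k S (\<lambda>x. \<Sum>i\<in>I. F i x)"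
  using assms(2)
  by (induction I rule: infinite_finite_induct) (auto intro: Ck_on_const Ck_on_add[OF assms(1)])

text \<open>One rule for scaling, products, inner products and the ambient form. The induction
  closes because each summand of the product rule pairs a derivative, which is
  \<open>Ck_on k\<close>, with an undifferentiated factor lowered by
  \<open>Ck_on_Suc_imp\<close>.\<close>

lemma Ck_on_bilinear:
  assumes "bounded_bilinear pr" "open S" "Ck_on k S F" "Ck_on k S G"
  shows "Ck_on k S (\<lambda>x. pr (F x) (G x))"
  using assms(3,4)
proof (induction k arbitrary: F G)
  case 0
  then show ?case using bounded_bilinear.continuous_on[OF assms(1)] by auto
next
  case (Suc k)
  have diff: "F differentiable (at x)" "G differentiable (at x)" if "x \<in> S" for x
    using Ck_on_differentiable[OF assms(2) _ that] Suc.prems by auto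
  have der: "((\<lambda>x. pr (F x) (G x)) has_derivative
      (\<lambda>v. pr (F x) (frechet_derivative G (at x) v) + pr (frechet_derivative F (at x) v) (G x)))
      (at x)" if "x \<in> S" for x
    by (rule bounded_bilinear.FDERIV[OF assms(1) frechet_derivative_worksI[OF diff(1)]
          frechet_derivative_worksI[OF diff(2)]]) (use that in auto)
  have "Ck_on k S (\<lambda>x. pr (F x) (frechet_derivative G (at x) v)
      + pr (frechet_derivative F (at x) v) (G x))" for v
    using Suc.prems by (intro Ck_on_add assms Suc.IH) (auto intro: Ck_on_Suc_imp)
  then have "Ck_on k S (\<lambda>x. frechet_derivative (\<lambda>x. pr (F x) (G x)) (at x) v)" for v
    by (subst Ck_on_cong[OF assms(2)]) (auto simp: frechet_derivative_at[OF der, symmetric])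
  moreover have "(\<lambda>x. pr (F x) (G x)) differentiable_on S"
    using der unfolding differentiable_on_def
    by (meson differentiable_at_withinI differentiable_def)
  ultimately show ?case by simp
qed

text \<open>The derivative of the reciprocal contains the reciprocal itself, but only to order
  \<open>k\<close>, which the induction hypothesis supplies.\<close>

lemma Ck_on_inverse:
  fixes h :: "'a::euclidean_space \<Rightarrow> real"
  assumes "open S" "Ck_on k S h" "\<And>x. x \<in> S \<Longrightarrow> h x \<noteq> 0"
  shows "Ck_on k S (\<lambda>x. inverse (h x))"
  using assms(2)
proof (induction k)
  case 0
  then show ?case using assms by (auto intro: continuous_on_inverse)
next
  case (Suc k)
  then have IH: "Ck_on k S (\<lambda>x. inverse (h x))" using Ck_on_Suc_imp by blast
  have der: "((\<lambda>x. inverse (h x)) has_derivative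
      (\<lambda>v. - (inverse (h x) * frechet_derivative h (at x) v * inverse (h x)))) (at x)"
    if "x \<in> S" for x
    by (rule Deriv.has_derivative_inverse[OF assms(3)[OF that]
          frechet_derivative_worksI[OF Ck_on_differentiable[OF assms(1) Suc.prems that]]])
  have "Ck_on k S (\<lambda>x. -1 * (inverse (h x) * frechet_derivative h (at x) v * inverse (h x)))" for v
    using Suc.prems by (intro Ck_on_bilinear[OF bounded_bilinear_mult] Ck_on_const assms IH) auto
  then have "Ck_on k S (\<lambda>x. frechet_derivative (\<lambda>x. inverse (h x)) (at x) v)" for v
    by (subst Ck_on_cong[OF assms(1)]) (auto simp: frechet_derivative_at[OF der, symmetric])
  moreover have "(\<lambda>x. inverse (h x)) differentiable_on S"
    using der unfolding differentiable_on_def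
    by (meson differentiable_at_withinI differentiable_def)
  ultimately show ?case by simp
qed

text \<open>\<open>Ck_on\<close> speaks only of derivatives in fixed directions. Expanding in
  \<open>Basis\<close> reduces a direction that varies with the point to finitely many fixed ones,
  with the coefficients as separate factors.\<close>

lemma frechet_derivative_basis:
  fixes G :: "'b::euclidean_space \<Rightarrow> 'c::real_normed_vector"
  assumes "G differentiable (at y)"
  shows "frechet_derivative G (at y) u = (\<Sum>b\<in>Basis. (u \<bullet> b) *\<^sub>R frechet_derivative G (at y) b)"
  by (subst (1) euclidean_representation[of u, symmetric])
    (simp only: linear_sum[OF linear_frechet_derivative[OF assms]]
      linear_cmul[OF linear_frechet_derivative[OF assms]])

lemma Ck_on_compose:
  fixes \<tau> :: "'a::euclidean_space \<Rightarrow> 'b::euclidean_space" and G :: "'b \<Rightarrow> 'c::real_normed_vector"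
  assumes "open S" "open S'" "\<tau> ` S \<subseteq> S'" "Ck_on k S \<tau>" "Ck_on k S' G"
  shows "Ck_on k S (\<lambda>x. G (\<tau> x))"
  using assms(4,5)
proof (induction k arbitrary: G)
  case 0
  then show ?case using continuous_on_compose2[of S' G S \<tau>] assms(3) by simp
next
  case (Suc k)
  have d\<tau>: "\<tau> differentiable (at x)" if "x \<in> S" for x
    by (rule Ck_on_differentiable[OF assms(1) Suc.prems(1) that])
  have dG: "G differentiable (at (\<tau> x))" if "x \<in> S" for x
    using assms(3) that by (intro Ck_on_differentiable[OF assms(2) Suc.prems(2)]) auto
  \<comment> \<open>The chain rule is written in coordinates so that the induction hypothesis
    applies to the partial derivatives of \<open>G\<close> composed with
    \<open>\<tau>\<close>.\<close>
  have der: "((\<lambda>x. G (\<tau> x)) has_derivative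
      (\<lambda>v. \<Sum>b\<in>Basis. (frechet_derivative \<tau> (at x) v \<bullet> b) *\<^sub>R frechet_derivative G (at (\<tau> x)) b)) (at x)"
    if "x \<in> S" for x
    unfolding frechet_derivative_basis[OF dG[OF that], symmetric]
    by (rule has_derivative_compose[OF frechet_derivative_worksI[OF d\<tau>[OF that]]
        frechet_derivative_worksI[OF dG[OF that]]])
  have "Ck_on k S (\<lambda>x. frechet_derivative G (at (\<tau> x)) b)" for b
    using Suc.prems by (intro Suc.IH) (auto intro: Ck_on_Suc_imp)
  moreover have "Ck_on k S (\<lambda>x. frechet_derivative \<tau> (at x) v \<bullet> b)" for v b
    using Suc.prems by (intro Ck_on_bilinear[OF bounded_bilinear_inner assms(1)] Ck_on_const) auto
  ultimately have "Ck_on k S (\<lambda>x. \<Sum>b\<in>Basis. (frechet_derivative \<tau> (at x) v \<bullet> b)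
      *\<^sub>R frechet_derivative G (at (\<tau> x)) b)" for v
    by (intro Ck_on_sum Ck_on_bilinear[OF bounded_bilinear_scaleR] assms)
  then have "Ck_on k S (\<lambda>x. frechet_derivative (\<lambda>x. G (\<tau> x)) (at x) v)" for v
    by (subst Ck_on_cong[OF assms(1)]) (auto simp: frechet_derivative_at[OF der, symmetric])
  moreover have "(\<lambda>x. G (\<tau> x)) differentiable_on S"
    using der unfolding differentiable_on_def
    by (meson differentiable_at_withinI differentiable_def)
  ultimately show ?case by simp
qed

lemma smooth_on_cong:
  "open S \<Longrightarrow> (\<And>x. x \<in> S \<Longrightarrow> F x = G x) \<Longrightarrow> smooth_on S F \<longleftrightarrow> smooth_on S G"
  unfolding smooth_on_def using Ck_on_cong by blast

lemma smooth_on_subset: "smooth_on S F \<Longrightarrow> T \<subseteq> S \<Longrightarrow> smooth_on T F"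
  unfolding smooth_on_def using Ck_on_subset by blast

lemma smooth_on_local:
  assumes "\<And>x. x \<in> S \<Longrightarrow> \<exists>T. open T \<and> x \<in> T \<and> smooth_on T F"
  shows "smooth_on S F"
  unfolding smooth_on_def
proof
  fix k
  show "Ck_on k S F" by (rule Ck_on_local) (use assms in \<open>auto simp: smooth_on_def\<close>)
qed

lemma smooth_on_const: "smooth_on S (\<lambda>x. c)"
  by (simp add: smooth_on_def Ck_on_const)

lemma smooth_on_add:
  "open S \<Longrightarrow> smooth_on S F \<Longrightarrow> smooth_on S G \<Longrightarrow> smooth_on S (\<lambda>x. F x + G x)"
  by (simp add: smooth_on_def Ck_on_add)

lemma smooth_on_sum:
  "open S \<Longrightarrow> (\<And>i. i \<in> I \<Longrightarrow> smooth_on S (F i)) \<Longrightarrow> smooth_on S (\<lambda>x. \<Sum>i\<in>I. F i x)"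
  by (simp add: smooth_on_def Ck_on_sum)

lemma smooth_on_bilinear:
  "bounded_bilinear pr \<Longrightarrow> open S \<Longrightarrow> smooth_on S F \<Longrightarrow> smooth_on S G
    \<Longrightarrow> smooth_on S (\<lambda>x. pr (F x) (G x))"
  by (simp add: smooth_on_def Ck_on_bilinear)

lemma smooth_on_inverse:
  fixes h :: "'a::euclidean_space \<Rightarrow> real"
  shows "open S \<Longrightarrow> smooth_on S h \<Longrightarrow> (\<And>x. x \<in> S \<Longrightarrow> h x \<noteq> 0)
    \<Longrightarrow> smooth_on S (\<lambda>x. inverse (h x))"
  by (simp add: smooth_on_def Ck_on_inverse)

lemma smooth_on_compose:
  "open S \<Longrightarrow> open S' \<Longrightarrow> \<tau> ` S \<subseteq> S' \<Longrightarrow> smooth_on S \<tau> \<Longrightarrow> smooth_on S' G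
    \<Longrightarrow> smooth_on S (\<lambda>x. G (\<tau> x))"
  unfolding smooth_on_def by (blast intro: Ck_on_compose[of S S'])

lemma smooth_on_differentiable:
  "open S \<Longrightarrow> smooth_on S F \<Longrightarrow> x \<in> S \<Longrightarrow> F differentiable (at x)"
  unfolding smooth_on_def using Ck_on_differentiable by blast

lemma smooth_on_derivative:
  assumes "smooth_on S F"
  shows "smooth_on S (\<lambda>x. frechet_derivative F (at x) v)"
  unfolding smooth_on_def
proof
  fix k
  have "Ck_on (Suc k) S F" using assms by (simp add: smooth_on_def)
  then show "Ck_on k S (\<lambda>x. frechet_derivative F (at x) v)" by simp
qed

lemma smooth_on_continuous: "smooth_on S F \<Longrightarrow> continuous_on S F"
  unfolding smooth_on_def by (metis Ck_on.simps(1))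

lemma smooth_on_derivative_along:
  fixes G :: "'a::euclidean_space \<Rightarrow> 'b::real_normed_vector"
  assumes "open S" "smooth_on S G" "smooth_on S u"
  shows "smooth_on S (\<lambda>x. frechet_derivative G (at x) (u x))"
proof -
  have "smooth_on S (\<lambda>x. \<Sum>b\<in>Basis. (u x \<bullet> b) *\<^sub>R frechet_derivative G (at x) b)"
    using assms by (intro smooth_on_sum smooth_on_bilinear[OF bounded_bilinear_scaleR]
        smooth_on_bilinear[OF bounded_bilinear_inner] smooth_on_derivative smooth_on_const)
  then show ?thesis
    by (rule smooth_on_cong[OF assms(1), THEN iffD1, rotated])
      (rule frechet_derivative_basis[symmetric], rule smooth_on_differentiable[OF assms(1,2)])
qed

text \<open>The first summand freezes the direction at \<open>u x\<close>, the second differentiates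
  the direction. In a commutator of two fields the first summands cancel by symmetry and the second
  ones form the bracket.\<close>

lemma derivative_derivative_along:
  fixes G :: "'a::euclidean_space \<Rightarrow> 'b::real_normed_vector"
  assumes "open S" "smooth_on S G" "smooth_on S u" "x \<in> S"
  shows "frechet_derivative (\<lambda>y. frechet_derivative G (at y) (u y)) (at x) v =
    frechet_derivative (\<lambda>y. frechet_derivative G (at y) (u x)) (at x) v
    + frechet_derivative G (at x) (frechet_derivative u (at x) v)"
proof -
  let ?D = "\<lambda>b y. frechet_derivative G (at y) b"
  have dD: "(?D b has_derivative frechet_derivative (?D b) (at x)) (at x)" for b
    by (intro frechet_derivative_worksI smooth_on_differentiable[OF assms(1)] smooth_on_derivative
        assms)
  have du: "(u has_derivative frechet_derivative u (at x)) (at x)"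
    by (intro frechet_derivative_worksI smooth_on_differentiable[OF assms(1)] assms)
  have "((\<lambda>y. \<Sum>b\<in>Basis. (u y \<bullet> b) *\<^sub>R ?D b y) has_derivative
     (\<lambda>v. \<Sum>b\<in>Basis. (u x \<bullet> b) *\<^sub>R frechet_derivative (?D b) (at x) v
        + (frechet_derivative u (at x) v \<bullet> b) *\<^sub>R ?D b x)) (at x)"
    by (intro has_derivative_sum has_derivative_scaleR has_derivative_inner_left du dD)
  moreover have "((\<lambda>y. \<Sum>b\<in>Basis. (u x \<bullet> b) *\<^sub>R ?D b y) has_derivative
     (\<lambda>v. \<Sum>b\<in>Basis. (u x \<bullet> b) *\<^sub>R frechet_derivative (?D b) (at x) v)) (at x)"
    by (intro has_derivative_sum has_derivative_scaleR_right dD)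
  moreover have D: "?D w y = (\<Sum>b\<in>Basis. (w \<bullet> b) *\<^sub>R ?D b y)" if "y \<in> S" for w y
    by (rule frechet_derivative_basis[OF smooth_on_differentiable[OF assms(1,2) that]])
  ultimately have der:
    "((\<lambda>y. ?D (u y) y) has_derivative (\<lambda>v. \<Sum>b\<in>Basis. (u x \<bullet> b) *\<^sub>R frechet_derivative (?D b) (at x) v
        + (frechet_derivative u (at x) v \<bullet> b) *\<^sub>R ?D b x)) (at x)"
    "(?D (u x) has_derivative (\<lambda>v. \<Sum>b\<in>Basis. (u x \<bullet> b) *\<^sub>R frechet_derivative (?D b) (at x) v)) (at x)"
    by - (rule has_derivative_transform_within_open[OF _ assms(1,4) D[symmetric]], assumption+)+
  show ?thesis
    unfolding frechet_derivative_at[OF der(1), symmetric] frechet_derivative_at[OF der(2), symmetric]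
    by (simp add: sum.distrib D[OF assms(4), of "frechet_derivative u (at x) v"])
qed

section \<open>Symmetry of second derivatives\<close>

text \<open>The mean value theorem is applied twice: in \<open>t\<close> to the difference of
  \<open>g\<close> along two parallel segments, then in \<open>s\<close> to its derivative. The left
  side does not change when \<open>v\<close> and \<open>w\<close> are exchanged, which is the source
  of Schwarz's theorem.\<close>

lemma second_difference:
  fixes g :: "'a::real_normed_vector \<Rightarrow> real"
  assumes "r > 0"
    and dom: "\<And>s t. \<lbrakk>0 \<le> s; s \<le> r; 0 \<le> t; t \<le> r\<rbrakk> \<Longrightarrow> x + s *\<^sub>R v + t *\<^sub>R w \<in> S"
    and d1: "\<And>y. y \<in> S \<Longrightarrow> g differentiable (at y)"
    and d2: "\<And>y. y \<in> S \<Longrightarrow> (\<lambda>z. frechet_derivative g (at z) w) differentiable (at y)"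
  shows "\<exists>s t. 0 < s \<and> s < r \<and> 0 < t \<and> t < r \<and>
    g (x + r *\<^sub>R v + r *\<^sub>R w) - g (x + r *\<^sub>R v) - g (x + r *\<^sub>R w) + g x =
    r * (r * frechet_derivative (\<lambda>z. frechet_derivative g (at z) w) (at (x + s *\<^sub>R v + t *\<^sub>R w)) v)"
proof -
  let ?g' = "\<lambda>z. frechet_derivative g (at z) w"
  have line: "((\<lambda>t. h (a + t *\<^sub>R u)) has_real_derivative frechet_derivative h (at (a + t *\<^sub>R u)) u) (at t)"
    if "h differentiable (at (a + t *\<^sub>R u))" for h :: "'a \<Rightarrow> real" and a u t
  proof -
    have "((\<lambda>t. a + t *\<^sub>R u) has_derivative (\<lambda>t. t *\<^sub>R u)) (at t)"
      using has_derivative_add[OF has_derivative_const has_derivative_scaleR_left[OF has_derivative_ident]]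
      by simp
    from has_derivative_compose[OF this frechet_derivative_worksI[OF that]]
    show ?thesis
      by (simp add: has_field_derivative_def linear_cmul[OF linear_frechet_derivative[OF that]]
          mult_commute_abs)
  qed
  have "((\<lambda>t. g (x + r *\<^sub>R v + t *\<^sub>R w) - g (x + t *\<^sub>R w)) has_real_derivative
      ?g' (x + r *\<^sub>R v + t *\<^sub>R w) - ?g' (x + t *\<^sub>R w)) (at t)" if "0 \<le> t" "t \<le> r" for t
    using dom[of r t] dom[of 0 t] that assms(1) d1 by (intro DERIV_diff line) auto
  from MVT2[OF assms(1), of "\<lambda>t. g (x + r *\<^sub>R v + t *\<^sub>R w) - g (x + t *\<^sub>R w)", OF this]
  obtain t where t: "0 < t" "t < r"
    "g (x + r *\<^sub>R v + r *\<^sub>R w) - g (x + r *\<^sub>R w) - (g (x + r *\<^sub>R v) - g x)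
      = r * (?g' (x + r *\<^sub>R v + t *\<^sub>R w) - ?g' (x + t *\<^sub>R w))" by auto
  have "((\<lambda>s. ?g' (x + t *\<^sub>R w + s *\<^sub>R v)) has_real_derivative
      frechet_derivative ?g' (at (x + t *\<^sub>R w + s *\<^sub>R v)) v) (at s)" if "0 \<le> s" "s \<le> r" for s
    using dom[of s t] that t d2 by (intro line) (auto simp: ac_simps)
  from MVT2[OF assms(1), of "\<lambda>s. ?g' (x + t *\<^sub>R w + s *\<^sub>R v)", OF this]
  obtain s where s: "0 < s" "s < r"
    "?g' (x + t *\<^sub>R w + r *\<^sub>R v) - ?g' (x + t *\<^sub>R w)
      = r * frechet_derivative ?g' (at (x + t *\<^sub>R w + s *\<^sub>R v)) v" by auto
  show ?thesis
    using s t by (intro exI[of _ s] exI[of _ t]) (simp add: ac_simps)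
qed

lemma symmetric_second_derivative_real:
  fixes g :: "'a::euclidean_space \<Rightarrow> real"
  assumes "open S" "smooth_on S g" "x \<in> S"
  shows "frechet_derivative (\<lambda>z. frechet_derivative g (at z) w) (at x) v
    = frechet_derivative (\<lambda>z. frechet_derivative g (at z) v) (at x) w"
proof (rule ccontr)
  define a where "a v w y = frechet_derivative (\<lambda>z. frechet_derivative g (at z) w) (at y) v" for v w y
  \<comment> \<open>Half the gap between the two mixed derivatives at \<open>x\<close>: values
    closer than \<open>e\<close> to one and to the other cannot agree.\<close>
  define e where "e = \<bar>a v w x - a w v x\<bar> / 2"
  assume "\<not> ?thesis"
  then have "e > 0" by (simp add: e_def a_def)
  have cont: "continuous_on S (a v w)" for v w
    unfolding a_def using assms by (intro smooth_on_continuous smooth_on_derivative)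
  obtain d1 where d1: "d1 > 0" "ball x d1 \<subseteq> S" using assms by (meson open_contains_ball)
  have "\<exists>d>0. \<forall>y. dist y x < d \<longrightarrow> \<bar>a v w y - a v w x\<bar> < e" for v w
    using cont[of v w] assms \<open>e > 0\<close>
    by (simp add: continuous_on_eq_continuous_at continuous_at dist_real_def
        tendsto_iff eventually_at) (metis abs_zero diff_self)
  then obtain d2 d3 where
    d2: "d2 > 0" "\<And>y. dist y x < d2 \<Longrightarrow> \<bar>a v w y - a v w x\<bar> < e" and
    d3: "d3 > 0" "\<And>y. dist y x < d3 \<Longrightarrow> \<bar>a w v y - a w v x\<bar> < e" by metis
  define d where "d = min d1 (min d2 d3)"
  \<comment> \<open>Small enough that the parallelogram with sides \<open>r *\<^sub>R v\<close> and
    \<open>r *\<^sub>R w\<close> stays within distance \<open>d\<close> of \<open>x\<close>; the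
    summand 1 keeps the denominator positive when both vectors vanish.\<close>
  define r where "r = d / (2 * (norm v + norm w + 1))"
  have "d > 0" using d1 d2 d3 by (simp add: d_def)
  then have "r > 0" by (simp add: r_def add_nonneg_pos)
  have near: "dist (x + s *\<^sub>R v + t *\<^sub>R w) x < d" if "0 \<le> s" "s \<le> r" "0 \<le> t" "t \<le> r" for s t
  proof -
    have "norm (s *\<^sub>R v + t *\<^sub>R w) \<le> s * norm v + t * norm w"
      using norm_triangle_ineq[of "s *\<^sub>R v" "t *\<^sub>R w"] that by simp
    also have "\<dots> \<le> r * norm v + r * norm w"
      using that by (intro add_mono mult_right_mono) auto
    also have "\<dots> < r * (2 * (norm v + norm w + 1))"
      using \<open>r > 0\<close> by (simp add: distrib_left) (smt (verit) mult_nonneg_nonneg norm_ge_zero)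
    also have "\<dots> = d"
      unfolding r_def by (smt (verit) nonzero_eq_divide_eq norm_ge_zero times_divide_eq_left)
    finally show ?thesis by (simp add: dist_norm add.assoc)
  qed
  have diff: "g differentiable (at y)" "(\<lambda>z. frechet_derivative g (at z) w) differentiable (at y)"
    if "y \<in> ball x d" for w y
  proof -
    have "y \<in> S" using that d1 by (auto simp: d_def)
    then show "g differentiable (at y)" "(\<lambda>z. frechet_derivative g (at z) w) differentiable (at y)"
      by (auto intro!: smooth_on_differentiable[OF assms(1)] smooth_on_derivative assms)
  qed
  have "\<exists>s t. 0 < s \<and> s < r \<and> 0 < t \<and> t < r \<and>
    g (x + r *\<^sub>R v + r *\<^sub>R w) - g (x + r *\<^sub>R v) - g (x + r *\<^sub>R w) + g x =
    r * (r * a v w (x + s *\<^sub>R v + t *\<^sub>R w))"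
    unfolding a_def using near diff
    by (intro second_difference[of r x v w "ball x d"] \<open>r > 0\<close>) (auto simp: dist_commute)
  then obtain s t where st: "0 < s" "s < r" "0 < t" "t < r"
    "g (x + r *\<^sub>R v + r *\<^sub>R w) - g (x + r *\<^sub>R v) - g (x + r *\<^sub>R w) + g x =
      r * (r * a v w (x + s *\<^sub>R v + t *\<^sub>R w))" by blast
  have near': "dist (x + s *\<^sub>R w + t *\<^sub>R v) x < d" if "0 \<le> s" "s \<le> r" "0 \<le> t" "t \<le> r" for s t
    using near[of t s] that by (simp add: ac_simps)
  have "\<exists>s t. 0 < s \<and> s < r \<and> 0 < t \<and> t < r \<and>
    g (x + r *\<^sub>R w + r *\<^sub>R v) - g (x + r *\<^sub>R w) - g (x + r *\<^sub>R v) + g x =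
    r * (r * a w v (x + s *\<^sub>R w + t *\<^sub>R v))"
    unfolding a_def using near' diff
    by (intro second_difference[of r x w v "ball x d"] \<open>r > 0\<close>) (auto simp: dist_commute)
  then obtain s' t' where st': "0 < s'" "s' < r" "0 < t'" "t' < r"
    "g (x + r *\<^sub>R w + r *\<^sub>R v) - g (x + r *\<^sub>R w) - g (x + r *\<^sub>R v) + g x =
      r * (r * a w v (x + s' *\<^sub>R w + t' *\<^sub>R v))" by blast
  have "r * (r * a v w (x + s *\<^sub>R v + t *\<^sub>R w)) = r * (r * a w v (x + s' *\<^sub>R w + t' *\<^sub>R v))"
    using st(5) st'(5) by (simp add: algebra_simps)
  then have "a v w (x + s *\<^sub>R v + t *\<^sub>R w) = a w v (x + s' *\<^sub>R w + t' *\<^sub>R v)"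
    using \<open>r > 0\<close> by simp
  moreover have "\<bar>a v w (x + s *\<^sub>R v + t *\<^sub>R w) - a v w x\<bar> < e"
    using near[of s t] st by (intro d2) (simp add: d_def)
  moreover have "\<bar>a w v (x + s' *\<^sub>R w + t' *\<^sub>R v) - a w v x\<bar> < e"
    using near'[of s' t'] st' by (intro d3) (simp add: d_def)
  ultimately show False by (simp add: e_def abs_if split: if_splits)
qed

lemma symmetric_second_derivative:
  fixes G :: "'a::euclidean_space \<Rightarrow> 'b::euclidean_space"
  assumes "open S" "smooth_on S G" "x \<in> S"
  shows "frechet_derivative (\<lambda>z. frechet_derivative G (at z) w) (at x) v
    = frechet_derivative (\<lambda>z. frechet_derivative G (at z) v) (at x) w"
proof (rule euclidean_eqI)
  fix b :: 'b
  have inner: "frechet_derivative (\<lambda>z. H z \<bullet> b) (at y) u = frechet_derivative H (at y) u \<bullet> b"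
    if "smooth_on S H" "y \<in> S" for H :: "'a \<Rightarrow> 'b" and y u
    using smooth_on_differentiable[OF assms(1) that]
    by (intro fun_cong[OF frechet_derivative_at[symmetric]] has_derivative_inner_left
        frechet_derivative_worksI)
  have "frechet_derivative (\<lambda>z. frechet_derivative G (at z) w) (at x) v \<bullet> b
      = frechet_derivative (\<lambda>z. frechet_derivative (\<lambda>z. G z \<bullet> b) (at z) w) (at x) v" for v w
  proof -
    have D: "smooth_on S (\<lambda>z. frechet_derivative G (at z) w)"
      using assms smooth_on_derivative by blast
    have "(\<lambda>z. frechet_derivative G (at z) w \<bullet> b) differentiable (at x)"
      using smooth_on_differentiable[OF assms(1) D assms(3)]
      by (intro differentiable_inner) auto
    then have "frechet_derivative (\<lambda>z. frechet_derivative G (at z) w \<bullet> b) (at x)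
      = frechet_derivative (\<lambda>z. frechet_derivative (\<lambda>z. G z \<bullet> b) (at z) w) (at x)"
      by (rule frechet_derivative_transform_within_open[OF _ assms(1,3)])
        (simp add: inner assms(2))
    with inner[OF D assms(3)] show ?thesis by metis
  qed
  moreover have "smooth_on S (\<lambda>z. G z \<bullet> b)"
    using assms by (intro smooth_on_bilinear[OF bounded_bilinear_inner] smooth_on_const)
  ultimately show "frechet_derivative (\<lambda>z. frechet_derivative G (at z) w) (at x) v \<bullet> b
    = frechet_derivative (\<lambda>z. frechet_derivative G (at z) v) (at x) w \<bullet> b"
    using symmetric_second_derivative_real assms by metis
qed

section \<open>Calculus on manifolds\<close>

locale smooth_mfd =
  fixes M :: "'p topology" and A :: "('p, 'd::euclidean_space) atlas"
  assumes manifold: "smooth_manifold M A"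
begin

lemma chart_open: "(V, \<phi>) \<in> A \<Longrightarrow> openin M V"
  using manifold by (auto simp: smooth_manifold_def)

lemma chart_subset: "(V, \<phi>) \<in> A \<Longrightarrow> V \<subseteq> topspace M"
  using chart_open openin_subset by blast

lemma chart_homeo:
  "(V, \<phi>) \<in> A \<Longrightarrow> homeomorphic_map (subtopology M V) (top_of_set (\<phi> ` V)) \<phi>"
  using manifold by (auto simp: smooth_manifold_def)

lemma chart_image_open:
  assumes "(V, \<phi>) \<in> A" "openin M U"
  shows "open (\<phi> ` (U \<inter> V))"
proof -
  have "openin (subtopology M V) (U \<inter> V)"
    using assms(2) by (simp add: openin_subtopology_Int)
  then have "openin (top_of_set (\<phi> ` V)) (\<phi> ` (U \<inter> V))"
    using homeomorphic_imp_open_map[OF chart_homeo[OF assms(1)]] by (simp add: open_map_def)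
  moreover have "open (\<phi> ` V)" using manifold assms(1) by (auto simp: smooth_manifold_def)
  ultimately show ?thesis by (simp add: openin_open_eq)
qed

lemma chart_inj: "(V, \<phi>) \<in> A \<Longrightarrow> inj_on \<phi> V"
  using homeomorphic_imp_injective_map[OF chart_homeo] chart_subset
  by (metis inf.absorb_iff2 topspace_subtopology)

lemma chart_inv: "(V, \<phi>) \<in> A \<Longrightarrow> q \<in> V \<Longrightarrow> inv_into V \<phi> (\<phi> q) = q"
  using chart_inj inv_into_f_f by metis

lemma transition_smooth:
  "(V, \<phi>) \<in> A \<Longrightarrow> (W, \<psi>) \<in> A \<Longrightarrow> smooth_on (\<phi> ` (V \<inter> W)) (\<psi> \<circ> inv_into V \<phi>)"
  using manifold by (auto simp: smooth_manifold_def)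

lemma chart_at_chart:
  assumes "p \<in> topspace M" "chart_at A p = (V, \<phi>)"
  shows "(V, \<phi>) \<in> A" "p \<in> V"
proof -
  have "topspace M = (\<Union>(V, \<phi>)\<in>A. V)" using manifold by (simp add: smooth_manifold_def)
  then have "\<exists>c. c \<in> A \<and> p \<in> fst c" using assms(1) by fastforce
  from someI_ex[OF this] show "(V, \<phi>) \<in> A" "p \<in> V"
    using assms(2) unfolding chart_at_def[symmetric] by auto
qed

lemma tdiff_eq:
  "chart_at A p = (V, \<phi>) \<Longrightarrow> tdiff A F p = frechet_derivative (F \<circ> inv_into V \<phi>) (at (\<phi> p))"
  by (auto simp: tdiff_def)

lemma smooth_mapD:
  "smooth_map A U F \<Longrightarrow> (V, \<phi>) \<in> A \<Longrightarrow> smooth_on (\<phi> ` (U \<inter> V)) (F \<circ> inv_into V \<phi>)"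
  by (auto simp: smooth_map_def)

lemma smooth_mapI:
  "(\<And>V \<phi>. (V, \<phi>) \<in> A \<Longrightarrow> smooth_on (\<phi> ` (U \<inter> V)) (F \<circ> inv_into V \<phi>)) \<Longrightarrow> smooth_map A U F"
  by (auto simp: smooth_map_def)

lemma smooth_map_subset: "smooth_map A U F \<Longrightarrow> U' \<subseteq> U \<Longrightarrow> smooth_map A U' F"
  by (intro smooth_mapI) (erule (1) smooth_on_subset[OF smooth_mapD], auto)

lemma smooth_map_cong:
  assumes "openin M U" "\<And>q. q \<in> U \<Longrightarrow> F q = G q" "smooth_map A U F"
  shows "smooth_map A U G"
proof (rule smooth_mapI)
  fix V \<phi> assume c: "(V, \<phi>) \<in> A"
  show "smooth_on (\<phi> ` (U \<inter> V)) (G \<circ> inv_into V \<phi>)"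
    by (rule smooth_on_cong[OF chart_image_open[OF c assms(1)], THEN iffD1, OF _ smooth_mapD[OF assms(3) c]])
      (use assms(2) chart_inv[OF c] in auto)
qed

lemma smooth_map_local:
  assumes "\<And>q. q \<in> U \<Longrightarrow> \<exists>U'. openin M U' \<and> q \<in> U' \<and> smooth_map A U' F"
  shows "smooth_map A U F"
proof (intro smooth_mapI smooth_on_local)
  fix V \<phi> x assume c: "(V, \<phi>) \<in> A" "x \<in> \<phi> ` (U \<inter> V)"
  then obtain q where q: "q \<in> U" "q \<in> V" "x = \<phi> q" by blast
  obtain U' where "openin M U'" "q \<in> U'" "smooth_map A U' F" using assms[OF q(1)] by blast
  then show "\<exists>T. open T \<and> x \<in> T \<and> smooth_on T (F \<circ> inv_into V \<phi>)"
    using chart_image_open[OF c(1)] smooth_mapD c(1) q by (intro exI[of _ "\<phi> ` (U' \<inter> V)"]) auto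
qed

lemma smooth_map_const: "smooth_map A U (\<lambda>q. c)"
  by (rule smooth_mapI) (simp add: comp_def smooth_on_const)

lemma smooth_map_add:
  assumes "openin M U" "smooth_map A U F" "smooth_map A U G"
  shows "smooth_map A U (\<lambda>q. F q + G q)"
  using smooth_on_add[OF chart_image_open[OF _ assms(1)]
      smooth_mapD[OF assms(2)] smooth_mapD[OF assms(3)]]
  by (intro smooth_mapI) (simp add: comp_def)

lemma smooth_map_sum:
  assumes "openin M U" "\<And>i. i \<in> I \<Longrightarrow> smooth_map A U (F i)"
  shows "smooth_map A U (\<lambda>q. \<Sum>i\<in>I. F i q)"
  using assms(2)
  by (induction I rule: infinite_finite_induct)
    (auto intro: smooth_map_const smooth_map_add[OF assms(1)])

lemma smooth_map_bilinear:
  assumes "bounded_bilinear pr" "openin M U" "smooth_map A U F" "smooth_map A U G"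
  shows "smooth_map A U (\<lambda>q. pr (F q) (G q))"
  using smooth_on_bilinear[OF assms(1) chart_image_open[OF _ assms(2)]
      smooth_mapD[OF assms(3)] smooth_mapD[OF assms(4)]]
  by (intro smooth_mapI) (simp add: comp_def)

lemma smooth_map_scaleR:
  "openin M U \<Longrightarrow> smooth_map A U h \<Longrightarrow> smooth_map A U G \<Longrightarrow> smooth_map A U (\<lambda>q. h q *\<^sub>R G q)"
  by (rule smooth_map_bilinear[OF bounded_bilinear_scaleR])

lemma smooth_map_mult:
  fixes h k :: "'p \<Rightarrow> real"
  shows "openin M U \<Longrightarrow> smooth_map A U h \<Longrightarrow> smooth_map A U k \<Longrightarrow> smooth_map A U (\<lambda>q. h q * k q)"
  by (rule smooth_map_bilinear[OF bounded_bilinear_mult])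

lemma smooth_map_diff:
  assumes "openin M U" "smooth_map A U F" "smooth_map A U G"
  shows "smooth_map A U (\<lambda>q. F q - G q)"
  using smooth_map_add[OF assms(1,2) smooth_map_scaleR[OF assms(1) smooth_map_const[of U "-1"] assms(3)]]
  by simp

lemma smooth_map_inverse:
  fixes h :: "'p \<Rightarrow> real"
  assumes "openin M U" "smooth_map A U h" "\<And>q. q \<in> U \<Longrightarrow> h q \<noteq> 0"
  shows "smooth_map A U (\<lambda>q. inverse (h q))"
proof (rule smooth_mapI)
  fix V \<phi> assume c: "(V, \<phi>) \<in> A"
  have "(h \<circ> inv_into V \<phi>) x \<noteq> 0" if "x \<in> \<phi> ` (U \<inter> V)" for x
    using that assms(3) chart_inv[OF c] by auto
  from smooth_on_inverse[OF chart_image_open[OF c assms(1)] smooth_mapD[OF assms(2) c] this]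
  show "smooth_on (\<phi> ` (U \<inter> V)) ((\<lambda>q. inverse (h q)) \<circ> inv_into V \<phi>)"
    by (simp add: comp_def)
qed

lemma smooth_map_chart:
  assumes "(V, \<phi>) \<in> A" shows "smooth_map A V \<phi>"
  using transition_smooth[OF _ assms] by (intro smooth_mapI) (simp add: Int_commute)

lemma smooth_map_compose_chart:
  assumes "(V, \<phi>) \<in> A" "openin M U" "U \<subseteq> V" "smooth_on (\<phi> ` U) K"
  shows "smooth_map A U (\<lambda>q. K (\<phi> q))"
proof (rule smooth_mapI)
  fix W \<psi> assume c: "(W, \<psi>) \<in> A"
  have "smooth_on (\<psi> ` (U \<inter> W)) (\<lambda>x. K ((\<phi> \<circ> inv_into W \<psi>) x))"
  proof (rule smooth_on_compose[OF _ _ _ _ assms(4)])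
    show "open (\<phi> ` U)" using chart_image_open[OF assms(1,2)] assms(3) by (simp add: Int_absorb2)
    show "smooth_on (\<psi> ` (U \<inter> W)) (\<phi> \<circ> inv_into W \<psi>)"
      by (rule smooth_on_subset[OF transition_smooth[OF c assms(1)]]) (use assms(3) in auto)
  qed (use chart_image_open[OF c assms(2)] chart_inv[OF c] in auto)
  then show "smooth_on (\<psi> ` (U \<inter> W)) ((\<lambda>q. K (\<phi> q)) \<circ> inv_into W \<psi>)"
    by (simp add: comp_def)
qed

lemma smooth_map_chart_derivative:
  assumes "smooth_map A U F" "openin M U" "p \<in> U" "(V, \<phi>) \<in> A" "p \<in> V"
  shows "(F \<circ> inv_into V \<phi> has_derivative frechet_derivative (F \<circ> inv_into V \<phi>) (at (\<phi> p))) (at (\<phi> p))"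
  using assms by (intro frechet_derivative_worksI
      smooth_on_differentiable[OF chart_image_open[OF assms(4,2)]] smooth_mapD) auto

lemma chart_change:
  assumes "smooth_map A U F" "openin M U" "p \<in> U" "(V, \<phi>) \<in> A" "p \<in> V" "(W, \<psi>) \<in> A" "p \<in> W"
  shows "frechet_derivative (F \<circ> inv_into W \<psi>) (at (\<psi> p)) v =
    frechet_derivative (F \<circ> inv_into V \<phi>) (at (\<phi> p))
      (frechet_derivative (\<phi> \<circ> inv_into W \<psi>) (at (\<psi> p)) v)"
proof -
  let ?S = "\<psi> ` ((U \<inter> V) \<inter> W)"
  have S: "open ?S" by (intro chart_image_open[OF assms(6)] openin_Int assms chart_open[OF assms(4)])
  have inv: "inv_into W \<psi> (\<psi> p) = p" using chart_inv assms by blast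
  have "((F \<circ> inv_into V \<phi>) \<circ> (\<phi> \<circ> inv_into W \<psi>) has_derivative
     frechet_derivative (F \<circ> inv_into V \<phi>) (at (\<phi> p)) \<circ>
     frechet_derivative (\<phi> \<circ> inv_into W \<psi>) (at (\<psi> p))) (at (\<psi> p))"
    using smooth_map_chart_derivative[OF assms(1-5)]
    by (intro diff_chain_at smooth_map_chart_derivative[OF smooth_map_chart[OF assms(4)]]
        chart_open[OF assms(4)] assms) (simp add: inv)
  then have "(F \<circ> inv_into W \<psi> has_derivative frechet_derivative (F \<circ> inv_into V \<phi>) (at (\<phi> p)) \<circ>
     frechet_derivative (\<phi> \<circ> inv_into W \<psi>) (at (\<psi> p))) (at (\<psi> p))"
    by (rule has_derivative_transform_within_open[OF _ S])
      (use assms chart_inv[OF assms(4)] chart_inv[OF assms(6)] in auto)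
  from frechet_derivative_at[OF this] show ?thesis by (metis comp_apply)
qed

text \<open>The preferred chart in \<open>tdiff\<close> may jump from point to point. This rule
  moves the derivative into one fixed chart, where \<open>tdiff A \<phi> p v\<close> gives the
  coordinates of \<open>v\<close>.\<close>

lemma tdiff_chart:
  assumes "smooth_map A U F" "openin M U" "p \<in> U" "(V, \<phi>) \<in> A" "p \<in> V"
  shows "tdiff A F p v = frechet_derivative (F \<circ> inv_into V \<phi>) (at (\<phi> p)) (tdiff A \<phi> p v)"
proof -
  obtain W \<psi> where c: "chart_at A p = (W, \<psi>)" by fastforce
  have "p \<in> topspace M" using assms(2,3) openin_subset by blast
  from chart_at_chart[OF this c] show ?thesis
    unfolding tdiff_eq[OF c] by (rule chart_change[OF assms])
qed

lemma tdiff_has_derivative: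
  assumes "smooth_map A U F" "openin M U" "p \<in> U" "chart_at A p = (V, \<phi>)"
  shows "(F \<circ> inv_into V \<phi> has_derivative tdiff A F p) (at (\<phi> p))"
proof -
  have "p \<in> topspace M" using assms(2,3) openin_subset by blast
  from smooth_map_chart_derivative[OF assms(1-3) chart_at_chart[OF this assms(4)]]
  show ?thesis by (simp add: tdiff_eq[OF assms(4)])
qed

lemma tdiff_unique:
  assumes "chart_at A p = (V, \<phi>)" "(F \<circ> inv_into V \<phi> has_derivative D) (at (\<phi> p))"
  shows "tdiff A F p = D"
  unfolding tdiff_eq[OF assms(1)] using frechet_derivative_at[OF assms(2)] by simp

lemma linear_tdiff:
  assumes "smooth_map A U F" "openin M U" "p \<in> U"
  shows "linear (tdiff A F p)"
  by (metis assms has_derivative_linear surj_pair tdiff_has_derivative)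

lemma tdiff_cong:
  assumes "openin M U" "p \<in> U" "\<And>q. q \<in> U \<Longrightarrow> F q = G q" "smooth_map A U F"
  shows "tdiff A F p = tdiff A G p"
proof -
  obtain V \<phi> where c: "chart_at A p = (V, \<phi>)" by fastforce
  have "p \<in> topspace M" using assms openin_subset by blast
  note ch = chart_at_chart[OF this c]
  have "(G \<circ> inv_into V \<phi> has_derivative tdiff A F p) (at (\<phi> p))"
    by (rule has_derivative_transform_within_open[OF tdiff_has_derivative[OF assms(4,1,2) c]
          chart_image_open[OF ch(1) assms(1)]]) (use assms ch chart_inv[OF ch(1)] in auto)
  from tdiff_unique[OF c this] show ?thesis by simp
qed

lemma tdiff_const: "tdiff A (\<lambda>q. c) p v = 0"
  by (cases "chart_at A p") (simp add: tdiff_eq comp_def)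

lemma tdiff_bounded_linear:
  assumes "bounded_linear L" "openin M U" "p \<in> U" "smooth_map A U F"
  shows "tdiff A (\<lambda>q. L (F q)) p v = L (tdiff A F p v)"
proof -
  obtain V \<phi> where c: "chart_at A p = (V, \<phi>)" by fastforce
  show ?thesis
    using bounded_linear.has_derivative[OF assms(1) tdiff_has_derivative[OF assms(4,2,3) c]]
    by (subst tdiff_unique[OF c, where D = "\<lambda>v. L (tdiff A F p v)"]) (auto simp: comp_def)
qed

lemma tdiff_bilinear:
  assumes "bounded_bilinear pr" "openin M U" "p \<in> U" "smooth_map A U F" "smooth_map A U G"
  shows "tdiff A (\<lambda>q. pr (F q) (G q)) p v = pr (F p) (tdiff A G p v) + pr (tdiff A F p v) (G p)"
proof -
  obtain V \<phi> where c: "chart_at A p = (V, \<phi>)" by fastforce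
  have "p \<in> topspace M" using assms openin_subset by blast
  note ch = chart_at_chart[OF this c]
  show ?thesis
    using bounded_bilinear.FDERIV[OF assms(1) tdiff_has_derivative[OF assms(4,2,3) c]
        tdiff_has_derivative[OF assms(5,2,3) c]] chart_inv[OF ch]
    by (subst tdiff_unique[OF c, where
          D = "\<lambda>v. pr (F p) (tdiff A G p v) + pr (tdiff A F p v) (G p)"]) (auto simp: comp_def)
qed

subsection \<open>Vector fields\<close>

lemma smooth_field_subset: "smooth_field A U X \<Longrightarrow> U' \<subseteq> U \<Longrightarrow> smooth_field A U' X"
  unfolding smooth_field_def by (fast intro: smooth_map_subset)

lemma smooth_field_chart:
  "smooth_field A U X \<Longrightarrow> (V, \<phi>) \<in> A \<Longrightarrow> smooth_map A (U \<inter> V) (\<lambda>q. tdiff A \<phi> q (X q))"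
  by (auto simp: smooth_field_def)

lemma tdiff_field_chart:
  assumes "smooth_map A U G" "openin M U" "(V, \<phi>) \<in> A" "x \<in> \<phi> ` (U \<inter> V)"
  shows "tdiff A G (inv_into V \<phi> x) (X (inv_into V \<phi> x))
    = frechet_derivative (G \<circ> inv_into V \<phi>) (at x) (((\<lambda>q. tdiff A \<phi> q (X q)) \<circ> inv_into V \<phi>) x)"
  using assms(4) chart_inv[OF assms(3)] tdiff_chart[OF assms(1,2) _ assms(3)] by auto

lemma smooth_map_tdiff:
  assumes "openin M U" "smooth_map A U G" "smooth_field A U X"
  shows "smooth_map A U (\<lambda>q. tdiff A G q (X q))"
proof (rule smooth_mapI)
  fix V \<phi> assume c: "(V, \<phi>) \<in> A"
  let ?u = "(\<lambda>q. tdiff A \<phi> q (X q)) \<circ> inv_into V \<phi>"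
  note S = chart_image_open[OF c assms(1)]
  have "smooth_on (\<phi> ` (U \<inter> V)) ?u"
    using smooth_mapD[OF smooth_field_chart[OF assms(3) c] c] by (simp add: Int_assoc)
  from smooth_on_derivative_along[OF S smooth_mapD[OF assms(2) c] this]
  show "smooth_on (\<phi> ` (U \<inter> V)) ((\<lambda>q. tdiff A G q (X q)) \<circ> inv_into V \<phi>)"
    by (rule smooth_on_cong[OF S, THEN iffD1, rotated]) (simp add: tdiff_field_chart[OF assms(2,1) c])
qed

text \<open>In the preferred chart at \<open>p\<close> the pure second derivatives of
  \<open>G\<close> cancel by Schwarz's theorem; what is left are the derivatives of the coordinates
  of the two fields, that is, the bracket. In other words, the flat derivative has no
  curvature.\<close>

lemma tdiff_commutator:
  fixes G :: "'p \<Rightarrow> 'b::euclidean_space"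
  assumes "openin M U" "p \<in> U" "smooth_map A U G" "smooth_field A U X" "smooth_field A U Y"
  shows "tdiff A (\<lambda>q. tdiff A G q (Y q)) p (X p) - tdiff A (\<lambda>q. tdiff A G q (X q)) p (Y p)
    = tdiff A G p (lie_bracket A X Y p)"
proof -
  obtain V \<phi> where c: "chart_at A p = (V, \<phi>)" by fastforce
  have "p \<in> topspace M" using assms openin_subset by blast
  note ch = chart_at_chart[OF this c]
  let ?S = "\<phi> ` (U \<inter> V)"
  let ?G = "G \<circ> inv_into V \<phi>"
  let ?u = "\<lambda>X. (\<lambda>q. tdiff A \<phi> q (X q)) \<circ> inv_into V \<phi>"
  have S: "open ?S" "\<phi> p \<in> ?S" using chart_image_open[OF ch(1) assms(1)] assms(2) ch by auto
  have G: "smooth_on ?S ?G" by (rule smooth_mapD[OF assms(3) ch(1)])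
  have u: "smooth_on ?S (?u X)" if "smooth_field A U X" for X
    using smooth_mapD[OF smooth_field_chart[OF that ch(1)] ch(1)] by (simp add: Int_assoc)
  \<comment> \<open>In its own preferred chart a tangent vector is its coordinate vector.\<close>
  have "((\<phi> \<circ> inv_into V \<phi>) has_derivative (\<lambda>v. v)) (at (\<phi> p))"
    by (rule has_derivative_transform_within_open[OF has_derivative_ident S])
      (use chart_inv[OF ch(1)] in auto)
  then have \<phi>: "tdiff A \<phi> p v = v" for v using tdiff_unique[OF c] by metis
  have D: "tdiff A (\<lambda>q. tdiff A G q (Y q)) p v =
      frechet_derivative (\<lambda>x. frechet_derivative ?G (at x) (Y p)) (at (\<phi> p)) v
      + tdiff A G p (tdiff A (\<lambda>q. tdiff A \<phi> q (Y q)) p v)"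
    if "smooth_field A U Y" for Y v
  proof -
    let ?K = "\<lambda>x. frechet_derivative ?G (at x) (?u Y x)"
    have "?K differentiable (at (\<phi> p))"
      by (rule smooth_on_differentiable[OF S(1) smooth_on_derivative_along[OF S(1) G u[OF that]] S(2)])
    then have "frechet_derivative ?K (at (\<phi> p))
      = frechet_derivative ((\<lambda>q. tdiff A G q (Y q)) \<circ> inv_into V \<phi>) (at (\<phi> p))"
      by (rule frechet_derivative_transform_within_open[OF _ S])
        (simp add: tdiff_field_chart[OF assms(3,1) ch(1)])
    then show ?thesis
      using derivative_derivative_along[OF S(1) G u[OF that] S(2), of v] chart_inv[OF ch]
      by (simp add: tdiff_eq[OF c, symmetric] \<phi>)
  qed
  have "tdiff A (\<lambda>q. tdiff A G q (Y q)) p (X p) - tdiff A (\<lambda>q. tdiff A G q (X q)) p (Y p)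
    = tdiff A G p (tdiff A (\<lambda>q. tdiff A \<phi> q (Y q)) p (X p))
      - tdiff A G p (tdiff A (\<lambda>q. tdiff A \<phi> q (X q)) p (Y p))"
    using symmetric_second_derivative[OF S(1) G S(2), of "Y p" "X p"]
    by (simp add: D assms(4,5))
  also have "\<dots> = tdiff A G p (lie_bracket A X Y p)"
    by (simp add: lie_bracket_def c linear_diff[OF linear_tdiff[OF assms(3,1,2)]])
  finally show ?thesis .
qed

section \<open>Coordinate fields of the preferred chart\<close>

lemma transition_inverse:
  assumes "(V, \<phi>) \<in> A" "(W, \<psi>) \<in> A" "q \<in> V" "q \<in> W"
  shows "frechet_derivative (\<phi> \<circ> inv_into W \<psi>) (at (\<psi> q))
    (frechet_derivative (\<psi> \<circ> inv_into V \<phi>) (at (\<phi> q)) a) = a"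
proof -
  have S: "open (\<phi> ` (V \<inter> V))" "\<phi> q \<in> \<phi> ` (V \<inter> V)"
    using chart_image_open[OF assms(1) chart_open[OF assms(1)]] assms(3) by auto
  have "((\<phi> \<circ> inv_into V \<phi>) has_derivative (\<lambda>v. v)) (at (\<phi> q))"
    by (rule has_derivative_transform_within_open[OF has_derivative_ident S])
      (use chart_inv[OF assms(1)] in auto)
  from frechet_derivative_at[OF this] show ?thesis
    using chart_change[OF smooth_map_chart[OF assms(1)] chart_open[OF assms(1)] assms(3) assms(2,4) assms(1,3), of a]
    by metis
qed

lemma tdiff_chart_const_field:
  assumes "p \<in> topspace M" "chart_at A p = (V, \<phi>)" "q \<in> V"
  shows "tdiff A \<phi> q (const_field A p a q) = a"
proof -
  obtain W \<psi> where c: "chart_at A q = (W, \<psi>)" by fastforce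
  note ch = chart_at_chart[OF assms(1,2)]
  have "q \<in> topspace M" using assms(3) chart_subset[OF ch(1)] by blast
  from transition_inverse[OF ch(1) chart_at_chart(1)[OF this c] assms(3) chart_at_chart(2)[OF this c]]
  show ?thesis by (simp add: const_field_def assms(2) c tdiff_eq[OF c])
qed

lemma const_field_tdiff_chart:
  assumes "p \<in> topspace M" "chart_at A p = (V, \<phi>)" "q \<in> V"
  shows "const_field A p (tdiff A \<phi> q v) q = v"
proof -
  obtain W \<psi> where c: "chart_at A q = (W, \<psi>)" by fastforce
  note ch = chart_at_chart[OF assms(1,2)]
  have "q \<in> topspace M" using assms(3) chart_subset[OF ch(1)] by blast
  from transition_inverse[OF chart_at_chart(1)[OF this c] ch(1) chart_at_chart(2)[OF this c] assms(3)]
  show ?thesis by (simp add: const_field_def assms(2) c tdiff_eq[OF c])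
qed

lemma tdiff_chart_at_self:
  assumes "p \<in> topspace M" "chart_at A p = (V, \<phi>)"
  shows "tdiff A \<phi> p v = v"
  using chart_change[OF smooth_map_chart chart_open] chart_at_chart[OF assms] transition_inverse
  by (metis tdiff_eq[OF assms(2)])

lemma const_field_self:
  assumes "p \<in> topspace M" shows "const_field A p a p = a"
proof -
  obtain V \<phi> where c: "chart_at A p = (V, \<phi>)" by fastforce
  show ?thesis
    using const_field_tdiff_chart[OF assms c chart_at_chart(2)[OF assms c]]
    by (metis tdiff_chart_at_self[OF assms c])
qed

lemma tdiff_const_field:
  assumes "p \<in> topspace M" "chart_at A p = (V, \<phi>)" "q \<in> V" "openin M U" "q \<in> U" "smooth_map A U G"
  shows "tdiff A G q (const_field A p a q) = frechet_derivative (G \<circ> inv_into V \<phi>) (at (\<phi> q)) a"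
  using tdiff_chart[OF assms(6,4,5) chart_at_chart(1)[OF assms(1,2)] assms(3)]
    tdiff_chart_const_field[OF assms(1-3)] by metis

lemma linear_const_field:
  assumes "p \<in> topspace M" "chart_at A p = (V, \<phi>)" "q \<in> V"
  shows "linear (\<lambda>a. const_field A p a q)"
proof -
  obtain W \<psi> where c: "chart_at A q = (W, \<psi>)" by fastforce
  note ch = chart_at_chart[OF assms(1,2)]
  have "q \<in> topspace M" using assms(3) chart_subset[OF ch(1)] by blast
  note cq = chart_at_chart[OF this c]
  have "linear (frechet_derivative (\<psi> \<circ> inv_into V \<phi>) (at (\<phi> q)))"
    by (rule has_derivative_linear[OF smooth_map_chart_derivative[OF smooth_map_chart[OF cq(1)]
          chart_open[OF cq(1)] cq(2) ch(1) assms(3)]])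
  then show ?thesis by (simp add: const_field_def assms(2) c)
qed

lemma smooth_field_const_field:
  assumes "p \<in> topspace M" "chart_at A p = (V, \<phi>)"
  shows "smooth_field A V (const_field A p a)"
  unfolding smooth_field_def
proof (clarify)
  fix W \<psi> assume c: "(W, \<psi>) \<in> A"
  note ch = chart_at_chart[OF assms]
  have VW: "openin M (V \<inter> W)" by (intro openin_Int chart_open[OF c] chart_open[OF ch(1)])
  have "smooth_map A (V \<inter> W) (\<lambda>q. frechet_derivative (\<psi> \<circ> inv_into V \<phi>) (at (\<phi> q)) a)"
    by (rule smooth_map_compose_chart[OF ch(1) VW _ smooth_on_derivative[OF transition_smooth[OF ch(1) c]]])
      simp
  then show "smooth_map A (V \<inter> W) (\<lambda>q. tdiff A \<psi> q (const_field A p a q))"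
    by (rule smooth_map_cong[OF VW, rotated])
      (simp add: tdiff_const_field[OF assms _ chart_open[OF c] _ smooth_map_chart[OF c]])
qed

lemma lie_bracket_const_field:
  assumes "p \<in> topspace M"
  shows "lie_bracket A (const_field A p a) (const_field A p b) p = 0"
proof -
  obtain V \<phi> where c: "chart_at A p = (V, \<phi>)" by fastforce
  note ch = chart_at_chart[OF assms c]
  have "tdiff A (\<lambda>q. tdiff A \<phi> q (const_field A p a q)) p = tdiff A (\<lambda>q. a) p" for a
    by (rule tdiff_cong[OF chart_open[OF ch(1)] ch(2), symmetric])
      (auto simp: tdiff_chart_const_field[OF assms c] intro: smooth_map_const)
  then show ?thesis by (simp add: lie_bracket_def c tdiff_const)
qed

end

section \<open>Orthonormal bases and traces\<close>

text \<open>The induction is one Gram-Schmidt step for an arbitrary inner product. The result gives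
  the choice in \<open>mean_curvature\<close> its meaning.\<close>

lemma orthonormal_basis_exists:
  fixes h :: "'d::euclidean_space \<Rightarrow> 'd \<Rightarrow> real"
  assumes "bilinear h" "\<And>v w. h v w = h w v" "\<And>v. v \<noteq> 0 \<Longrightarrow> h v v > 0"
  shows "\<exists>B. orthonormal_basis h B"
proof -
  have lin: "linear (h v)" "linear (\<lambda>v. h v w)" for v w using assms(1) by (auto simp: bilinear_def)
  have "\<exists>B. finite B \<and> card B = k \<and> (\<forall>a\<in>B. \<forall>b\<in>B. h a b = (if a = b then 1 else 0))"
    if "k \<le> DIM('d)" for k
    using that
  proof (induction k)
    case 0
    show ?case by (intro exI[of _ "{}"]) simp
  next
    case (Suc k)
    then obtain B where B: "finite B" "card B = k"
      "\<And>a b. a \<in> B \<Longrightarrow> b \<in> B \<Longrightarrow> h a b = (if a = b then 1 else 0)" by auto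
    have "dim (span B) \<le> k" using dim_le_card'[OF B(1)] B(2) by simp
    then have "span B \<noteq> UNIV" using Suc.prems by (metis Suc_n_not_le_n dim_UNIV le_trans)
    then obtain x where x: "x \<notin> span B" by blast
    define y where "y = x - (\<Sum>b\<in>B. h x b *\<^sub>R b)"
    have "y \<noteq> 0"
    proof
      assume "y = 0"
      then have "x = (\<Sum>b\<in>B. h x b *\<^sub>R b)" by (simp add: y_def)
      then show False using x by (metis (no_types, lifting) span_base span_scale span_sum)
    qed
    have yb: "h y b = 0" if "b \<in> B" for b
    proof -
      have "h y b = h x b - (\<Sum>a\<in>B. h x a * h a b)"
        by (simp add: y_def linear_diff[OF lin(2)] linear_sum[OF lin(2)] linear_cmul[OF lin(2)])
      also have "(\<Sum>a\<in>B. h x a * h a b) = (\<Sum>a\<in>B. if a = b then h x b else 0)"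
        by (intro sum.cong) (use B(3) that in auto)
      finally show ?thesis using B(1) that by simp
    qed
    define n where "n = (1 / sqrt (h y y)) *\<^sub>R y"
    have pos: "h y y > 0" using assms(3)[OF \<open>y \<noteq> 0\<close>] .
    have nn: "h n n = 1"
      using pos by (simp add: n_def linear_cmul[OF lin(1)] linear_cmul[OF lin(2)] flip: real_sqrt_mult)
    have nb: "h n b = 0" "h b n = 0" if "b \<in> B" for b
      using yb[OF that] assms(2)[of b n] by (simp_all add: n_def linear_cmul[OF lin(2)])
    have "n \<notin> B" using nb nn by force
    then show ?case
      using B nn nb by (intro exI[of _ "insert n B"]) auto
  qed
  then show ?thesis unfolding orthonormal_basis_def by blast
qed

lemma orthonormal_basis_expansion:
  fixes h :: "'d::euclidean_space \<Rightarrow> 'd \<Rightarrow> real"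
  assumes "orthonormal_basis h B" "bilinear h"
  shows "v = (\<Sum>b\<in>B. h v b *\<^sub>R b)"
proof -
  have lin: "linear (\<lambda>v. h v w)" for w using assms(2) by (auto simp: bilinear_def)
  have B: "finite B" "card B = DIM('d)"
    "\<And>a b. a \<in> B \<Longrightarrow> b \<in> B \<Longrightarrow> h a b = (if a = b then 1 else 0)"
    using assms(1) by (auto simp: orthonormal_basis_def)
  have coeff: "h (\<Sum>a\<in>B. c a *\<^sub>R a) b = c b" if "b \<in> B" for c b
  proof -
    have "h (\<Sum>a\<in>B. c a *\<^sub>R a) b = (\<Sum>a\<in>B. c a * h a b)"
      by (simp add: linear_sum[OF lin] linear_cmul[OF lin])
    also have "\<dots> = (\<Sum>a\<in>B. if a = b then c b else 0)"
      by (intro sum.cong) (use B(3) that in auto)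
    finally show ?thesis using B(1) that by simp
  qed
  have "independent B"
    by (subst independent_explicit) (metis B(1) coeff linear_0[OF lin])
  then have "span B = UNIV"
    using card_ge_dim_independent[of B UNIV] B(2) by auto
  then obtain c where "v = (\<Sum>b\<in>B. c b *\<^sub>R b)"
    using span_finite[OF B(1)] by (metis (no_types, lifting) UNIV_I imageE)
  moreover from this have "h v b = c b" if "b \<in> B" for b using coeff[OF that] by simp
  ultimately show ?thesis by simp
qed

text \<open>The trace is the contraction with any frame and its dual. Unlike an orthonormal basis
  chosen separately at each point, such a frame can be taken smooth in the point.\<close>

lemma trace_dual_frame:
  fixes h :: "'d::euclidean_space \<Rightarrow> 'd \<Rightarrow> real" and \<beta> :: "'d \<Rightarrow> 'd \<Rightarrow> 'b::euclidean_space"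
  assumes "orthonormal_basis h B" "bilinear h" "\<And>v w. h v w = h w v" "\<And>v. v \<noteq> 0 \<Longrightarrow> h v v > 0"
    and "bilinear \<beta>" "finite I" "span (e ` I) = UNIV"
    and dual: "\<And>i j. i \<in> I \<Longrightarrow> j \<in> I \<Longrightarrow> h (d i) (e j) = (if i = j then 1 else 0)"
  shows "(\<Sum>b\<in>B. \<beta> b b) = (\<Sum>i\<in>I. \<beta> (d i) (e i))"
proof -
  have lin: "linear (h v)" "linear (\<lambda>v. h v w)" for v w using assms(2) by (auto simp: bilinear_def)
  have lin\<beta>: "linear (\<beta> v)" "linear (\<lambda>v. \<beta> v w)" for v w using assms(5) by (auto simp: bilinear_def)
  have expand: "b = (\<Sum>i\<in>I. h b (e i) *\<^sub>R d i)" for b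
  proof -
    define x where "x = b - (\<Sum>i\<in>I. h b (e i) *\<^sub>R d i)"
    have "h x (e j) = 0" if "j \<in> I" for j
    proof -
      have "h x (e j) = h b (e j) - (\<Sum>i\<in>I. h b (e i) * h (d i) (e j))"
        by (simp add: x_def linear_diff[OF lin(2)] linear_sum[OF lin(2)] linear_cmul[OF lin(2)])
      also have "(\<Sum>i\<in>I. h b (e i) * h (d i) (e j)) = (\<Sum>i\<in>I. if i = j then h b (e j) else 0)"
        by (intro sum.cong) (use dual that in auto)
      finally show ?thesis using assms(6) that by simp
    qed
    note orth = this
    have "h x y = 0" if "y \<in> span (e ` I)" for y
      using that
    proof (induction rule: span_induct_alt)
      case base
      show ?case by (simp add: linear_0[OF lin(1)])
    next
      case (step c u y)
      then show ?case using orth by (auto simp: linear_add[OF lin(1)] linear_cmul[OF lin(1)])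
    qed
    then have "x = 0" using assms(4,7) by (metis UNIV_I less_irrefl)
    then show ?thesis by (simp add: x_def)
  qed
  have "(\<Sum>b\<in>B. \<beta> b b) = (\<Sum>b\<in>B. \<Sum>i\<in>I. h b (e i) *\<^sub>R \<beta> (d i) b)"
  proof (intro sum.cong refl)
    fix b
    have "\<beta> b b = \<beta> (\<Sum>i\<in>I. h b (e i) *\<^sub>R d i) b" using expand by metis
    then show "\<beta> b b = (\<Sum>i\<in>I. h b (e i) *\<^sub>R \<beta> (d i) b)"
      by (simp add: linear_sum[OF lin\<beta>(2)] linear_cmul[OF lin\<beta>(2)])
  qed
  also have "\<dots> = (\<Sum>i\<in>I. \<beta> (d i) (\<Sum>b\<in>B. h (e i) b *\<^sub>R b))"
    by (subst sum.swap) (simp add: linear_sum[OF lin\<beta>(1)] linear_cmul[OF lin\<beta>(1)] assms(3))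
  also have "\<dots> = (\<Sum>i\<in>I. \<beta> (d i) (e i))"
    using orthonormal_basis_expansion[OF assms(1,2)] by simp
  finally show ?thesis .
qed

section \<open>Smooth orthogonal projections\<close>

context smooth_mfd
begin

text \<open>Gram-Schmidt with smooth coefficients. Positivity is asked only on the span of the
  frame, because the ambient form is indefinite when \<epsilon> = -1.\<close>

lemma smooth_projection_coefficients:
  fixes B :: "'b::euclidean_space \<Rightarrow> 'b \<Rightarrow> real" and w :: "'p \<Rightarrow> 'b"
  assumes U: "openin M U" and B: "bounded_bilinear B"
    and "finite I" "\<And>i. i \<in> I \<Longrightarrow> smooth_map A U (u i)"
    and "\<And>q. q \<in> U \<Longrightarrow> inj_on (\<lambda>i. u i q) I"
    and "\<And>q. q \<in> U \<Longrightarrow> independent ((\<lambda>i. u i q) ` I)"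
    and "\<And>q v. q \<in> U \<Longrightarrow> v \<in> span ((\<lambda>i. u i q) ` I) \<Longrightarrow> v \<noteq> 0 \<Longrightarrow> B v v > 0"
    and "smooth_map A U w"
  shows "\<exists>c. (\<forall>i\<in>I. smooth_map A U (c i)) \<and>
    (\<forall>q\<in>U. \<forall>j\<in>I. B (w q - (\<Sum>i\<in>I. c i q *\<^sub>R u i q)) (u j q) = 0)"
  using assms(3-8)
proof (induction I arbitrary: w rule: finite_induct)
  case empty
  then show ?case by simp
next
  case (insert k I)
  interpret B: bounded_bilinear B by (rule B)
  have inj: "inj_on (\<lambda>i. u i q) I" and new: "u k q \<notin> span ((\<lambda>i. u i q) ` I)"
    and ind: "independent ((\<lambda>i. u i q) ` I)" if "q \<in> U" for q
  proof -
    show "inj_on (\<lambda>i. u i q) I" using insert.prems(2)[OF that] by (simp add: inj_on_insert)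
    have "u k q \<notin> (\<lambda>i. u i q) ` I" using insert.prems(2)[OF that] insert.hyps by auto
    then show "u k q \<notin> span ((\<lambda>i. u i q) ` I)" "independent ((\<lambda>i. u i q) ` I)"
      using insert.prems(3)[OF that] by (auto simp: independent_insert)
  qed
  have sub: "span ((\<lambda>i. u i q) ` I) \<subseteq> span ((\<lambda>i. u i q) ` insert k I)" for q
    by (intro span_mono) auto
  have IH: "\<exists>c. (\<forall>i\<in>I. smooth_map A U (c i)) \<and>
    (\<forall>q\<in>U. \<forall>j\<in>I. B (w q - (\<Sum>i\<in>I. c i q *\<^sub>R u i q)) (u j q) = 0)"
    if "smooth_map A U w" for w
  proof (rule insert.IH[OF _ inj ind _ that])
    show "B v v > 0" if "q \<in> U" "v \<in> span ((\<lambda>i. u i q) ` I)" "v \<noteq> 0" for q v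
      using insert.prems(4)[OF that(1)] that sub[of q] by blast
  qed (use insert.prems(1) in auto)
  obtain c0 where c0: "\<And>i. i \<in> I \<Longrightarrow> smooth_map A U (c0 i)"
    "\<And>q j. q \<in> U \<Longrightarrow> j \<in> I \<Longrightarrow> B (u k q - (\<Sum>i\<in>I. c0 i q *\<^sub>R u i q)) (u j q) = 0"
    using IH[OF insert.prems(1)[OF insertI1]] by auto
  obtain c1 where c1: "\<And>i. i \<in> I \<Longrightarrow> smooth_map A U (c1 i)"
    "\<And>q j. q \<in> U \<Longrightarrow> j \<in> I \<Longrightarrow> B (w q - (\<Sum>i\<in>I. c1 i q *\<^sub>R u i q)) (u j q) = 0"
    using IH[OF insert.prems(5)] by auto
  \<comment> \<open>\<open>v\<close> is the part of the new frame vector orthogonal to the earlier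
    ones, and \<open>x\<close> the same for \<open>w\<close>. Removing the multiple \<open>t\<close>
    of \<open>v\<close> from \<open>x\<close> also clears the pairing with
    \<open>u k\<close>.\<close>
  define v where "v q = u k q - (\<Sum>i\<in>I. c0 i q *\<^sub>R u i q)" for q
  define x where "x q = w q - (\<Sum>i\<in>I. c1 i q *\<^sub>R u i q)" for q
  define t where "t q = B (x q) (v q) * inverse (B (v q) (v q))" for q
  have in_span: "(\<Sum>i\<in>I. c i *\<^sub>R u i q) \<in> span ((\<lambda>i. u i q) ` I)" for c q
    by (intro span_sum span_scale span_base) auto
  have vpos: "B (v q) (v q) > 0" if "q \<in> U" for q
  proof (rule insert.prems(4)[OF that])
    show "v q \<in> span ((\<lambda>i. u i q) ` insert k I)"
      unfolding v_def using in_span[of "\<lambda>i. c0 i q" q] sub[of q]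
      by (intro span_diff) (auto intro: span_base)
    show "v q \<noteq> 0"
    proof
      assume "v q = 0"
      then have "u k q = (\<Sum>i\<in>I. c0 i q *\<^sub>R u i q)" by (simp add: v_def)
      then show False using new[OF that] in_span[of "\<lambda>i. c0 i q" q] by simp
    qed
  qed
  have smooth_comb: "smooth_map A U (\<lambda>q. y q - (\<Sum>i\<in>I. c i q *\<^sub>R u i q))"
    if "smooth_map A U y" "\<And>i. i \<in> I \<Longrightarrow> smooth_map A U (c i)" for y c
    using that insert.prems(1) by (intro smooth_map_diff U smooth_map_sum smooth_map_scaleR) auto
  have "smooth_map A U v" "smooth_map A U x"
    unfolding v_def x_def using insert.prems c0 c1 by (auto intro!: smooth_comb)
  then have t: "smooth_map A U t"
    unfolding t_def using vpos
    by (intro smooth_map_mult U smooth_map_inverse smooth_map_bilinear[OF B]) force+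
  \<comment> \<open>These coefficients express \<open>x - t v\<close> as \<open>w\<close> minus a
    combination of the original frame.\<close>
  define c where "c i = (if i = k then t else (\<lambda>q. c1 i q - t q * c0 i q))" for i
  have smooth: "\<forall>i\<in>insert k I. smooth_map A U (c i)"
    using t c0 c1 by (auto simp: c_def intro!: smooth_map_diff smooth_map_mult U)
  have res: "w q - (\<Sum>i\<in>insert k I. c i q *\<^sub>R u i q) = x q - t q *\<^sub>R v q" for q
  proof -
    have "(\<Sum>i\<in>I. c i q *\<^sub>R u i q) = (\<Sum>i\<in>I. c1 i q *\<^sub>R u i q - t q *\<^sub>R (c0 i q *\<^sub>R u i q))"
      using insert.hyps by (intro sum.cong) (auto simp: c_def scaleR_diff_left)
    then have "(\<Sum>i\<in>I. c i q *\<^sub>R u i q)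
        = (\<Sum>i\<in>I. c1 i q *\<^sub>R u i q) - t q *\<^sub>R (\<Sum>i\<in>I. c0 i q *\<^sub>R u i q)"
      by (simp only: sum_subtractf scaleR_sum_right)
    then show ?thesis
      using insert.hyps by (simp add: x_def v_def scaleR_diff_right) (simp add: c_def)
  qed
  have orth: "B (x q - t q *\<^sub>R v q) (u j q) = 0" if "q \<in> U" "j \<in> I" for q j
    using c0(2)[OF that] c1(2)[OF that]
    by (simp add: B.diff_left B.scaleR_left v_def[symmetric] x_def[symmetric])
  have "B (x q - t q *\<^sub>R v q) (u k q) = 0" if "q \<in> U" for q
  proof -
    have "u k q = v q + (\<Sum>i\<in>I. c0 i q *\<^sub>R u i q)" by (simp add: v_def)
    then have "B (x q - t q *\<^sub>R v q) (u k q) = B (x q - t q *\<^sub>R v q) (v q)"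
      using orth[OF that] by (simp add: B.add_right B.sum_right B.scaleR_right)
    then show ?thesis
      using vpos[OF that] by (simp add: B.diff_left B.scaleR_left t_def)
  qed
  with orth smooth show ?case by (intro exI[of _ c]) (auto simp only: res insert_iff)
qed

lemma const_field_nbhd:
  assumes "p \<in> topspace M"
  obtains V where "openin M V" "p \<in> V" "\<And>a. smooth_field A V (const_field A p a)"
    "\<And>q. q \<in> V \<Longrightarrow> linear (\<lambda>a. const_field A p a q)"
    "\<And>q. q \<in> V \<Longrightarrow> bij (\<lambda>a. const_field A p a q)"
proof -
  obtain V \<phi> where c: "chart_at A p = (V, \<phi>)" by fastforce
  note ch = chart_at_chart[OF assms c]
  show ?thesis
  proof (rule that[OF chart_open[OF ch(1)] ch(2) smooth_field_const_field[OF assms c]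
        linear_const_field[OF assms c]])
    fix q assume "q \<in> V"
    then show "bij (\<lambda>a. const_field A p a q)"
      by (intro o_bij[of "tdiff A \<phi> q"])
        (auto simp: fun_eq_iff tdiff_chart_const_field[OF assms c] const_field_tdiff_chart[OF assms c])
  qed
qed

end

section \<open>The ambient form\<close>

lemma ambient_form_eq:
  "ambient_form \<epsilon> x y = \<epsilon> * fst (fst x) * fst (fst y) + snd (fst x) \<bullet> snd (fst y) + snd x * snd y"
  by (metis ambient_form.simps prod.collapse)

lemma bounded_bilinear_ambient_form: "bounded_bilinear (ambient_form \<epsilon>)"
  unfolding bilinear_conv_bounded_bilinear[symmetric] bilinear_def
  by (auto intro!: linearI simp: ambient_form_eq algebra_simps inner_add_left inner_add_right)

lemma ambient_form_sym: "ambient_form \<epsilon> x y = ambient_form \<epsilon> y x"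
  by (simp add: ambient_form_eq inner_commute mult.commute mult.left_commute)

lemma ambient_form_pos:
  fixes y w :: "'e::euclidean_space ambient"
  assumes "\<epsilon> \<in> {-1, 1}" "fst y \<in> quadric \<epsilon>" "w \<in> product_tangent_space \<epsilon> y" "w \<noteq> 0"
  shows "ambient_form \<epsilon> w w > 0"
proof (cases "\<epsilon> = 1")
  case True
  then have "ambient_form \<epsilon> w w = w \<bullet> w" by (cases w) (simp add: ambient_form_eq inner_prod_def)
  with assms(4) show ?thesis by simp
next
  case False
  then have \<epsilon>: "\<epsilon> = -1" using assms(1) by simp
  obtain x0 x s where w: "w = ((x0, x), s)" by (metis prod.exhaust)
  obtain q0 q t where y: "y = ((q0, q), t)" by (metis prod.exhaust)
  have q: "q \<bullet> q = q0\<^sup>2 - 1" "q0 > 0" using assms(2) by (auto simp: quadric_def \<epsilon> y)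
  have "x \<bullet> q = x0 * q0" using assms(3) by (simp add: product_tangent_space_def \<epsilon> y w)
  \<comment> \<open>Tangency fixes \<open>x \<bullet> q\<close>, and Cauchy-Schwarz against
    \<open>q\<close>, whose squared length is \<open>q0\<^sup>2 - 1\<close>, bounds the timelike
    coordinate \<open>x0\<close>.\<close>
  then have "(x0 * q0)\<^sup>2 \<le> (x \<bullet> x) * (q0\<^sup>2 - 1)" using Cauchy_Schwarz_ineq[of x q] q by simp
  then have *: "x \<bullet> x \<le> (x \<bullet> x - x0\<^sup>2) * q0\<^sup>2" by (simp add: algebra_simps power_mult_distrib)
  have "s \<noteq> 0 \<or> x \<noteq> 0"
  proof (rule ccontr)
    assume zero: "\<not> ?thesis"
    then have "x0 = 0" using \<open>x \<bullet> q = x0 * q0\<close> q by simp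
    with zero show False using assms(4) w by (simp add: zero_prod_def)
  qed
  moreover have "0 \<le> x \<bullet> x - x0\<^sup>2"
    using * q(2) by (metis inner_ge_zero order_trans zero_le_mult_iff zero_less_power not_less)
  moreover have "0 < x \<bullet> x - x0\<^sup>2" if "x \<noteq> 0"
    using * q(2) that by (metis inner_gt_zero_iff less_le_trans zero_less_mult_pos2 zero_less_power)
  moreover have "ambient_form \<epsilon> w w = (x \<bullet> x - x0\<^sup>2) + s * s"
    by (simp add: w \<epsilon> power2_eq_square)
  ultimately show ?thesis
    by (metis add_nonneg_pos add_pos_nonneg not_real_square_gt_zero zero_le_square)
qed

section \<open>Isometric immersions into the product\<close>

text \<open>\<open>hor (f p)\<close> spans the normal line of the product at \<open>f p\<close>. As
  a linear function of the position it can be differentiated along \<open>f\<close>.\<close>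

definition hor :: "'e::euclidean_space ambient \<Rightarrow> 'e ambient" where
  "hor w = (fst w, 0)"

lemma bounded_linear_hor: "bounded_linear hor"
  unfolding hor_def by (intro bounded_linear_Pair bounded_linear_fst bounded_linear_zero)

lemma hor_d_dt: "w = hor w + snd w *\<^sub>R d_dt"
  by (cases w) (simp add: hor_def d_dt_def zero_prod_def[symmetric])

lemma ambient_form_hor: "ambient_form \<epsilon> w (hor z) = ambient_form \<epsilon> (hor w) (hor z)"
  by (simp add: ambient_form_eq hor_def)

locale immersed = smooth_mfd M A
  for M :: "'p topology" and A :: "('p, 'd::euclidean_space) atlas" +
  fixes g :: "'p \<Rightarrow> 'd \<Rightarrow> 'd \<Rightarrow> real" and \<epsilon> :: real and f :: "'p \<Rightarrow> 'e::euclidean_space ambient"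
  assumes \<epsilon>: "\<epsilon> \<in> {-1, 1}"
    and metric: "riemannian_metric M A g"
    and immersion: "isometric_immersion M A g \<epsilon> f"
begin

abbreviation ip :: "'e ambient \<Rightarrow> 'e ambient \<Rightarrow> real" where "ip \<equiv> ambient_form \<epsilon>"
abbreviation df :: "'p \<Rightarrow> 'd \<Rightarrow> 'e ambient" where "df \<equiv> tdiff A f"
abbreviation nor :: "'p \<Rightarrow> 'e ambient set" where "nor \<equiv> normal_space_at A \<epsilon> f"
abbreviation sff :: "'p \<Rightarrow> 'd \<Rightarrow> 'd \<Rightarrow> 'e ambient" where "sff \<equiv> second_fundamental_form A \<epsilon> f"

text \<open>Both projections occurring in the normal connection and in the second fundamental form
  at once, on every ambient vector, so that each of these becomes a flat derivative followed by
  \<open>np\<close>.\<close>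

definition np :: "'p \<Rightarrow> 'e ambient \<Rightarrow> 'e ambient" where
  "np p z = normal_part A \<epsilon> f p (product_tangent_part \<epsilon> (f p) z)"

lemma normal_connection_np: "normal_connection A \<epsilon> f p v \<xi> = np p (tdiff A \<xi> p v)"
  by (simp add: normal_connection_def ambient_connection_def np_def)

lemma sff_np: "sff p v w = np p (tdiff A (\<lambda>q. df q (const_field A p w q)) p v)"
  by (simp add: second_fundamental_form_def ambient_connection_def np_def)

interpretation ip: bounded_bilinear ip by (rule bounded_bilinear_ambient_form)

lemma \<epsilon>_square: "\<epsilon> * \<epsilon> = 1"
  using \<epsilon> by auto

lemma f_smooth: "smooth_map A (topspace M) f"
  using immersion by (simp add: isometric_immersion_def)

lemma df_ip: "p \<in> topspace M \<Longrightarrow> ip (df p v) (df p w) = g p v w"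
  using immersion by (simp add: isometric_immersion_def)

lemma df_inj: "p \<in> topspace M \<Longrightarrow> inj (df p)"
  using immersion by (simp add: isometric_immersion_def)

lemma linear_df: "p \<in> topspace M \<Longrightarrow> linear (df p)"
  using linear_tdiff[OF f_smooth openin_topspace] .

lemma f_quadric: "p \<in> topspace M \<Longrightarrow> fst (f p) \<in> quadric \<epsilon>"
  using immersion by (metis isometric_immersion_def mem_Times_iff)

lemma metric_props:
  assumes "p \<in> topspace M"
  shows "bilinear (g p)" "g p v w = g p w v" "v \<noteq> 0 \<Longrightarrow> g p v v > 0"
  using metric assms by (auto simp: riemannian_metric_def)

lemma ip_position:
  assumes "p \<in> topspace M" shows "ip (hor (f p)) (hor (f p)) = \<epsilon>"
  using f_quadric[OF assms]
  by (auto simp: quadric_def hor_def ambient_form_eq power2_eq_square split: prod.splits)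

lemma tdiff_ip:
  assumes "openin M U" "p \<in> U" "smooth_map A U F" "smooth_map A U G"
  shows "tdiff A (\<lambda>q. ip (F q) (G q)) p v = ip (F p) (tdiff A G p v) + ip (tdiff A F p v) (G p)"
  by (rule tdiff_bilinear[OF bounded_bilinear_ambient_form assms])

lemma tdiff_ip_zero:
  assumes "openin M U" "p \<in> U" "smooth_map A U F" "smooth_map A U G"
    and "\<And>q. q \<in> U \<Longrightarrow> ip (F q) (G q) = 0"
  shows "ip (F p) (tdiff A G p v) = - ip (tdiff A F p v) (G p)"
proof -
  have "tdiff A (\<lambda>q. 0) p = tdiff A (\<lambda>q. ip (F q) (G q)) p"
    by (rule tdiff_cong[OF assms(1,2)]) (simp_all add: assms(5) smooth_map_const)
  then have "tdiff A (\<lambda>q. ip (F q) (G q)) p v = 0" by (metis tdiff_const)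
  then show ?thesis by (simp add: tdiff_ip[OF assms(1-4)])
qed

lemma smooth_map_hor:
  fixes F :: "'p \<Rightarrow> 'e ambient"
  assumes "openin M U" "smooth_map A U F" shows "smooth_map A U (\<lambda>q. hor (F q))"
proof -
  have *: "bounded_bilinear (\<lambda>r w. r *\<^sub>R hor w :: 'e ambient)"
    by (rule bounded_bilinear.comp[OF bounded_bilinear_scaleR bounded_linear_ident bounded_linear_hor])
  show ?thesis using smooth_map_bilinear[OF * assms(1) smooth_map_const[of U 1] assms(2)] by simp
qed

lemma tdiff_hor:
  assumes "openin M U" "p \<in> U" "smooth_map A U F"
  shows "tdiff A (\<lambda>q. hor (F q)) p v = hor (tdiff A F p v)"
  by (rule tdiff_bounded_linear[OF bounded_linear_hor assms])

text \<open>Differentiate \<open>ip_position\<close>: the position vector has constant square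
  \<epsilon>.\<close>

lemma df_tangent:
  assumes "p \<in> topspace M" shows "ip (df p v) (hor (f p)) = 0"
proof -
  let ?n = "\<lambda>q. hor (f q)"
  note top = openin_topspace[of M]
  have n: "smooth_map A (topspace M) ?n" by (rule smooth_map_hor[OF top f_smooth])
  have "tdiff A (\<lambda>q. \<epsilon>) p = tdiff A (\<lambda>q. ip (?n q) (?n q)) p"
    by (rule tdiff_cong[OF top assms]) (simp_all add: ip_position smooth_map_const)
  then have "tdiff A (\<lambda>q. ip (?n q) (?n q)) p v = 0" by (metis tdiff_const)
  then have "ip (?n p) (hor (df p v)) + ip (hor (df p v)) (?n p) = 0"
    by (simp add: tdiff_ip[OF top assms n n] tdiff_hor[OF top assms f_smooth])
  then show ?thesis using ambient_form_sym[of \<epsilon>] ambient_form_hor[of \<epsilon>] by (metis add_cancel_right_left mult_2 mult_eq_0_iff zero_neq_numeral)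
qed

section \<open>Projection onto the normal space\<close>

lemma product_tangent_space_iff:
  "w \<in> product_tangent_space \<epsilon> (f p) \<longleftrightarrow> ip w (hor (f p)) = 0"
  by (simp add: product_tangent_space_def hor_def)

lemma ip_pos:
  assumes "p \<in> topspace M" "ip w (hor (f p)) = 0" "w \<noteq> 0" shows "ip w w > 0"
  using ambient_form_pos[OF \<epsilon> f_quadric[OF assms(1)]] assms by (simp add: product_tangent_space_iff)

lemma ip_self_zero:
  assumes "p \<in> topspace M" "ip w (hor (f p)) = 0" "ip w w = 0" shows "w = 0"
  using ip_pos[OF assms(1,2)] assms(3) by force

lemma nor_iff: "w \<in> nor p \<longleftrightarrow> ip w (hor (f p)) = 0 \<and> (\<forall>v. ip w (df p v) = 0)"
  by (simp add: normal_space_at_def product_tangent_space_iff)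

lemma subspace_nor: "subspace (nor p)"
  by (rule subspaceI) (auto simp: nor_iff ip.add_left ip.scaleR_left ip.zero_left)

text \<open>A vector that is both normal and tangent to the immersion pairs to zero with itself, and
  the form is positive on the tangent space of the product. This uniqueness and the existence in
  \<open>np_decomposition\<close> justify the \<open>THE\<close> in
  \<open>normal_part\<close>.\<close>

lemma np_eqI:
  assumes "p \<in> topspace M" "w \<in> nor p" "z = w + df p t + c *\<^sub>R hor (f p)"
  shows "np p z = w"
proof -
  have "ip z (hor (f p)) = c * \<epsilon>"
    using assms by (simp add: ip.add_left ip.scaleR_left df_tangent nor_iff ip_position)
  then have "\<epsilon> * ip z (hor (f p)) = c" using \<epsilon>_square by simp
  then have *: "product_tangent_part \<epsilon> (f p) z = w + df p t"
    using assms(3) by (simp add: product_tangent_part_def hor_def)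
  show ?thesis unfolding np_def * normal_part_def
  proof (rule the_equality)
    show "w \<in> nor p \<and> w + df p t - w \<in> range (df p)" using assms(2) by auto
    fix w' assume w': "w' \<in> nor p \<and> w + df p t - w' \<in> range (df p)"
    then obtain s where s: "w + df p t - w' = df p s" by blast
    have d: "w - w' \<in> nor p" using w' assms(2) subspace_diff[OF subspace_nor] by blast
    have "w - w' = df p (s - t)"
      using s by (simp add: linear_diff[OF linear_df[OF assms(1)]] algebra_simps)
    then have "ip (w - w') (w - w') = 0" using d by (metis nor_iff)
    then show "w' = w" using ip_self_zero[OF assms(1), of "w - w'"] d by (auto simp: nor_iff)
  qed
qed

lemma np_decomposition:
  assumes "p \<in> topspace M"
  obtains t c where "np p z \<in> nor p" "z = np p z + df p t + c *\<^sub>R hor (f p)"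
proof -
  obtain B where B: "orthonormal_basis (g p) B"
    using orthonormal_basis_exists[of "g p"] metric_props[OF assms] by blast
  define z1 where "z1 = z - (\<epsilon> * ip z (hor (f p))) *\<^sub>R hor (f p)"
  \<comment> \<open>The tangential component is expanded in a \<open>g p\<close>-orthonormal basis,
    whose image under the isometric \<open>df p\<close> is orthonormal for
    \<open>ip\<close>.\<close>
  define t where "t = (\<Sum>b\<in>B. ip z1 (df p b) *\<^sub>R b)"
  note lin = linear_df[OF assms]
  have "ip z1 (hor (f p)) = 0"
    using \<epsilon>_square by (simp add: z1_def ip.diff_left ip.scaleR_left ip_position[OF assms])
  moreover have "ip (df p t) (df p v) = ip z1 (df p v)" for v
  proof -
    have "v = (\<Sum>b\<in>B. g p v b *\<^sub>R b)"
      by (rule orthonormal_basis_expansion[OF B metric_props(1)[OF assms]])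
    then have "ip z1 (df p v) = ip z1 (df p (\<Sum>b\<in>B. g p v b *\<^sub>R b))" by simp
    also have "\<dots> = (\<Sum>b\<in>B. g p v b * ip z1 (df p b))"
      by (simp add: linear_sum[OF lin] linear_cmul[OF lin] ip.sum_right ip.scaleR_right)
    also have "\<dots> = ip (df p t) (df p v)"
      by (simp add: t_def linear_sum[OF lin] linear_cmul[OF lin] ip.sum_left ip.scaleR_left
          df_ip[OF assms] mult.commute metric_props(2)[OF assms, of v])
    finally show ?thesis by simp
  qed
  ultimately have "z1 - df p t \<in> nor p"
    by (simp add: nor_iff ip.diff_left df_tangent[OF assms])
  moreover have z: "z = (z1 - df p t) + df p t + (\<epsilon> * ip z (hor (f p))) *\<^sub>R hor (f p)"
    by (simp add: z1_def)
  ultimately show ?thesis using that np_eqI[OF assms] by metis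
qed

lemma np_nor: "p \<in> topspace M \<Longrightarrow> np p z \<in> nor p"
  using np_decomposition by metis

lemma np_normal: "p \<in> topspace M \<Longrightarrow> w \<in> nor p \<Longrightarrow> np p w = w"
  using np_eqI[of p w w 0 0] by (simp add: linear_0[OF linear_df])

lemma ip_np:
  assumes "p \<in> topspace M" "n \<in> nor p"
  shows "ip (np p z) n = ip z n"
proof -
  obtain t c where "z = np p z + df p t + c *\<^sub>R hor (f p)" using np_decomposition[OF assms(1)] .
  then have "ip z n = ip (np p z) n + ip (df p t) n + c * ip (hor (f p)) n"
    by (metis ip.add_left ip.scaleR_left real_scaleR_def)
  then show ?thesis using assms(2) by (simp add: nor_iff ambient_form_sym[of \<epsilon> _ n])
qed

lemma nor_eqI:
  assumes "p \<in> topspace M" "x \<in> nor p" "y \<in> nor p" "\<And>n. n \<in> nor p \<Longrightarrow> ip x n = ip y n"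
  shows "x = y"
proof -
  have d: "x - y \<in> nor p" using assms subspace_diff[OF subspace_nor] by blast
  then have "ip (x - y) (x - y) = 0" using assms(4) by (simp add: ip.diff_left)
  then show ?thesis using ip_self_zero[OF assms(1), of "x - y"] d by (auto simp: nor_iff)
qed

lemma linear_np:
  assumes "p \<in> topspace M" shows "linear (np p)"
proof (rule linearI)
  note sub = subspace_nor[of p]
  show "np p (x + y) = np p x + np p y" for x y
    by (rule nor_eqI[OF assms])
      (auto simp: np_nor[OF assms] subspace_add[OF sub] ip_np[OF assms] ip.add_left)
  show "np p (r *\<^sub>R x) = r *\<^sub>R np p x" for r x
    by (rule nor_eqI[OF assms])
      (auto simp: np_nor[OF assms] subspace_scale[OF sub] ip_np[OF assms] ip.scaleR_left)
qed

text \<open>Records, without naming a chart, what later proofs use of the preferred chart at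
  \<open>p\<close>: its coordinate fields form a smooth frame on \<open>V\<close>.\<close>

definition coordinate_nbhd :: "'p \<Rightarrow> 'p set \<Rightarrow> bool" where
  "coordinate_nbhd p V \<longleftrightarrow> openin M V \<and> p \<in> V \<and> (\<forall>a. smooth_field A V (const_field A p a)) \<and>
     (\<forall>q\<in>V. linear (\<lambda>a. const_field A p a q) \<and> bij (\<lambda>a. const_field A p a q))"

lemma coordinate_nbhd_exists: "p \<in> topspace M \<Longrightarrow> \<exists>V. coordinate_nbhd p V"
  unfolding coordinate_nbhd_def by (rule const_field_nbhd) blast+

lemma coordinate_nbhd_props:
  assumes "coordinate_nbhd p V"
  shows "openin M V" "p \<in> V" "V \<subseteq> topspace M" "smooth_field A V (const_field A p a)"
    "q \<in> V \<Longrightarrow> linear (\<lambda>a. const_field A p a q)"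
    "q \<in> V \<Longrightarrow> bij (\<lambda>a. const_field A p a q)"
    "smooth_map A V (\<lambda>q. df q (const_field A p a q))"
    "q \<in> V \<Longrightarrow> linear (\<lambda>a. df q (const_field A p a q))"
    "q \<in> V \<Longrightarrow> inj (\<lambda>a. df q (const_field A p a q))"
proof -
  show V: "openin M V" "p \<in> V" "smooth_field A V (const_field A p a)"
    "q \<in> V \<Longrightarrow> linear (\<lambda>a. const_field A p a q)"
    "q \<in> V \<Longrightarrow> bij (\<lambda>a. const_field A p a q)" for a q
    using assms by (auto simp: coordinate_nbhd_def)
  show sub: "V \<subseteq> topspace M" using V(1) openin_subset by blast
  show "smooth_map A V (\<lambda>q. df q (const_field A p a q))"
    by (rule smooth_map_tdiff[OF V(1) smooth_map_subset[OF f_smooth sub] V(3)])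
  show "linear (\<lambda>a. df q (const_field A p a q))" if "q \<in> V"
    using linear_compose[OF V(4)[OF that] linear_df[of q]] sub that by (auto simp: comp_def)
  show "inj (\<lambda>a. df q (const_field A p a q))" if "q \<in> V"
    using inj_compose[OF df_inj[of q] bij_is_inj[OF V(5)[OF that]]] sub that
    by (auto simp: comp_def)
qed

text \<open>Locally the images of the coordinate fields are a smooth frame of the tangent space of
  the immersion. Subtracting the position component and the projection onto this frame, with its
  smooth coefficients, leaves the normal part.\<close>

lemma smooth_map_np:
  assumes "openin M U" "smooth_map A U w"
  shows "smooth_map A U (\<lambda>q. np q (w q))"
proof (rule smooth_map_local)
  fix p assume "p \<in> U"
  have Utop: "U \<subseteq> topspace M" using assms(1) openin_subset by blast
  with \<open>p \<in> U\<close> have p: "p \<in> topspace M" by blast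
  then obtain V where "coordinate_nbhd p V" using coordinate_nbhd_exists by blast
  note V = coordinate_nbhd_props[OF this]
  note sm = V(7) and lin = V(8) and inj = V(9) and bij = V(6)
  let ?U = "U \<inter> V"
  let ?u = "\<lambda>a q. df q (const_field A p a q)"
  define w1 where "w1 q = w q - (\<epsilon> * ip (w q) (hor (f q))) *\<^sub>R hor (f q)" for q
  have U: "openin M ?U" using assms(1) V(1) by blast
  have w: "smooth_map A ?U w" using assms(2) smooth_map_subset by blast
  have hf: "smooth_map A ?U (\<lambda>q. hor (f q))"
    by (intro smooth_map_hor U smooth_map_subset[OF f_smooth]) (use Utop in blast)
  have w1: "smooth_map A ?U w1"
    unfolding w1_def by (intro smooth_map_diff smooth_map_scaleR smooth_map_mult smooth_map_const
        smooth_map_bilinear[OF bounded_bilinear_ambient_form] U w hf)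
  have ran: "span ((\<lambda>a. ?u a q) ` Basis) \<subseteq> range (df q)" if "q \<in> V" for q
    by (rule span_minimal) (use V(1) openin_subset that linear_df in
        \<open>auto intro!: linear_subspace_image[of "df q" UNIV]\<close>)
  have "\<exists>c. (\<forall>i\<in>Basis. smooth_map A ?U (c i)) \<and>
    (\<forall>q\<in>?U. \<forall>j\<in>Basis. ip (w1 q - (\<Sum>i\<in>Basis. c i q *\<^sub>R ?u i q)) (?u j q) = 0)"
  proof (rule smooth_projection_coefficients[OF U bounded_bilinear_ambient_form finite_Basis _ _ _ _ w1])
    fix q assume q: "q \<in> ?U"
    then show "inj_on (\<lambda>a. ?u a q) Basis" using inj inj_on_subset by blast
    show "independent ((\<lambda>a. ?u a q) ` Basis)"
      using linear_independent_injective_image[OF lin independent_Basis] inj q inj_on_subset by blast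
    fix v assume "v \<in> span ((\<lambda>a. ?u a q) ` Basis)" "v \<noteq> 0"
    then show "ip v v > 0" using ran[of q] q Utop df_tangent ip_pos[of q v] by blast
  qed (use sm smooth_map_subset in blast)
  then obtain c where c: "\<And>i. i \<in> Basis \<Longrightarrow> smooth_map A ?U (c i)"
    "\<And>q j. q \<in> ?U \<Longrightarrow> j \<in> Basis \<Longrightarrow> ip (w1 q - (\<Sum>i\<in>Basis. c i q *\<^sub>R ?u i q)) (?u j q) = 0" by blast
  define n where "n q = w1 q - (\<Sum>i\<in>Basis. c i q *\<^sub>R ?u i q)" for q
  have "np q (w q) = n q" if q: "q \<in> ?U" for q
  proof (rule np_eqI)
    show qt: "q \<in> topspace M" using q Utop by blast
    have "ip (w1 q) (hor (f q)) = 0"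
      using \<epsilon>_square by (simp add: w1_def ip.diff_left ip.scaleR_left ip_position[OF qt])
    then have "ip (n q) (hor (f q)) = 0"
      by (simp add: n_def ip.diff_left ip.sum_left ip.scaleR_left df_tangent[OF qt])
    moreover have "ip (n q) (df q v) = 0" for v
    proof -
      obtain a where "v = const_field A p a q"
        using bij_is_surj[OF bij, of q] q by (metis IntD2 surjD)
      then have "df q v = ?u (\<Sum>b\<in>Basis. (a \<bullet> b) *\<^sub>R b) q" by (simp add: euclidean_representation)
      also have "\<dots> = (\<Sum>b\<in>Basis. (a \<bullet> b) *\<^sub>R ?u b q)"
        using lin[of q] q by (subst linear_sum[of "\<lambda>a. ?u a q"]) (auto simp: linear_cmul[of "\<lambda>a. ?u a q"])
      finally show ?thesis using c(2)[OF q] by (simp add: n_def[symmetric] ip.sum_right ip.scaleR_right)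
    qed
    ultimately show "n q \<in> nor q" by (simp add: nor_iff)
    show "w q = n q + df q (\<Sum>i\<in>Basis. c i q *\<^sub>R const_field A p i q) + (\<epsilon> * ip (w q) (hor (f q))) *\<^sub>R hor (f q)"
      by (simp add: n_def w1_def linear_sum[OF linear_df[OF qt]] linear_cmul[OF linear_df[OF qt]])
  qed
  then have eq: "n q = np q (w q)" if "q \<in> ?U" for q using that by simp
  have "smooth_map A ?U n"
    unfolding n_def
    by (intro smooth_map_diff smooth_map_sum smooth_map_scaleR U w1 c(1) smooth_map_subset[OF sm]) auto
  then have "smooth_map A ?U (\<lambda>q. np q (w q))"
    by (rule smooth_map_cong[OF U, rotated]) (rule eq)
  then show "\<exists>U'. openin M U' \<and> p \<in> U' \<and> smooth_map A U' (\<lambda>q. np q (w q))"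
    using U \<open>p \<in> U\<close> V(2) by blast
qed

section \<open>The second fundamental form\<close>

text \<open>Differentiate \<open>ip (df q (Y q)) (\<mu> q) = 0\<close>. The right side involves
  \<open>Y\<close> only through its value at \<open>p\<close>, which is why the second fundamental
  form is tensorial.\<close>

lemma ip_df_derivative:
  assumes "openin M U" "p \<in> U" "smooth_field A U Y" "smooth_map A U \<mu>" "\<And>q. q \<in> U \<Longrightarrow> \<mu> q \<in> nor q"
  shows "ip (tdiff A (\<lambda>q. df q (Y q)) p v) (\<mu> p) = - ip (df p (Y p)) (tdiff A \<mu> p v)"
proof -
  have sub: "U \<subseteq> topspace M" using assms(1) openin_subset by blast
  have "ip (df p (Y p)) (tdiff A \<mu> p v) = - ip (tdiff A (\<lambda>q. df q (Y q)) p v) (\<mu> p)"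
  proof (rule tdiff_ip_zero[OF assms(1,2) _ assms(4)])
    show "smooth_map A U (\<lambda>q. df q (Y q))"
      by (rule smooth_map_tdiff[OF assms(1) smooth_map_subset[OF f_smooth sub] assms(3)])
    show "ip (df q (Y q)) (\<mu> q) = 0" if "q \<in> U" for q
      using assms(5)[OF that] by (simp add: nor_iff ambient_form_sym[of \<epsilon> "df q (Y q)"])
  qed
  then show ?thesis by simp
qed

text \<open>A normal vector \<open>n\<close> at one point is extended to a smooth normal section by
  projecting the constant \<open>n\<close> at every point.\<close>

lemma smooth_normal_extension: "smooth_map A (topspace M) (\<lambda>q. np q n)"
  by (rule smooth_map_np[OF openin_topspace smooth_map_const])

lemma ip_df_derivative_np:
  assumes "openin M U" "p \<in> U" "smooth_field A U Y" "n \<in> nor p"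
  shows "ip (tdiff A (\<lambda>q. df q (Y q)) p v) n = - ip (df p (Y p)) (tdiff A (\<lambda>q. np q n) p v)"
proof -
  have sub: "U \<subseteq> topspace M" using assms(1) openin_subset by blast
  have nor: "np q n \<in> nor q" if "q \<in> U" for q using np_nor sub that by blast
  have p: "p \<in> topspace M" using assms(2) sub by blast
  show ?thesis
    using ip_df_derivative[OF assms(1-3) smooth_map_subset[OF smooth_normal_extension sub] nor, of v]
    by (simp add: np_normal[OF p assms(4)])
qed

lemma ip_sff_np:
  assumes "p \<in> topspace M" "n \<in> nor p"
  shows "ip (sff p v w) n = - ip (df p w) (tdiff A (\<lambda>q. np q n) p v)"
proof -
  obtain V where "coordinate_nbhd p V" using coordinate_nbhd_exists[OF assms(1)] by blast
  note V = coordinate_nbhd_props[OF this]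
  show ?thesis
    using ip_df_derivative_np[OF V(1,2,4) assms(2), of w v]
    by (simp add: sff_np ip_np[OF assms] const_field_self[OF assms(1)])
qed

text \<open>Pairing with normal vectors removes the derivatives of \<open>Y\<close>.\<close>

lemma sff_field:
  assumes "openin M U" "p \<in> U" "smooth_field A U Y"
  shows "sff p v (Y p) = np p (tdiff A (\<lambda>q. df q (Y q)) p v)"
proof -
  have p: "p \<in> topspace M" using assms(1,2) openin_subset by blast
  show ?thesis
    by (rule nor_eqI[OF p])
      (auto simp: sff_np[of p v "Y p"] np_nor[OF p] ip_np[OF p] ip_df_derivative_np[OF assms]
        simp flip: ip_sff_np[OF p] intro: np_nor[OF p])
qed

lemma sff_nor: "p \<in> topspace M \<Longrightarrow> sff p v w \<in> nor p"
  by (simp add: sff_np np_nor)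

lemma bilinear_sff:
  assumes "p \<in> topspace M" shows "bilinear (sff p)"
  unfolding bilinear_def
proof (intro conjI allI linearI)
  obtain V where "coordinate_nbhd p V" using coordinate_nbhd_exists[OF assms(1)] by blast
  note V = coordinate_nbhd_props[OF this]
  note sub = subspace_nor[of p]
  fix w x y :: 'd and r :: real
  have lin: "linear (tdiff A (\<lambda>q. df q (const_field A p w q)) p)"
    by (rule linear_tdiff[OF V(7,1,2)])
  show "sff p (x + y) w = sff p x w + sff p y w"
    by (simp add: sff_np linear_add[OF lin] linear_add[OF linear_np[OF assms]])
  show "sff p (r *\<^sub>R x) w = r *\<^sub>R sff p x w"
    by (simp add: sff_np linear_cmul[OF lin] linear_cmul[OF linear_np[OF assms]])
  show "sff p w (x + y) = sff p w x + sff p w y"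
    by (rule nor_eqI[OF assms]) (auto simp: sff_nor[OF assms] subspace_add[OF sub] ip.add_left
        ip_sff_np[OF assms] linear_add[OF linear_df[OF assms]])
  show "sff p w (r *\<^sub>R x) = r *\<^sub>R sff p w x"
    by (rule nor_eqI[OF assms]) (auto simp: sff_nor[OF assms] subspace_scale[OF sub] ip.scaleR_left
        ip_sff_np[OF assms] linear_cmul[OF linear_df[OF assms]])
qed

lemma const_field_commute:
  fixes G :: "'p \<Rightarrow> 'b::euclidean_space"
  assumes "coordinate_nbhd p V" "openin M U" "p \<in> U" "smooth_map A U G"
  shows "tdiff A (\<lambda>q. tdiff A G q (const_field A p b q)) p a
    = tdiff A (\<lambda>q. tdiff A G q (const_field A p a q)) p b"
proof -
  note V = coordinate_nbhd_props[OF assms(1)]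
  have p: "p \<in> topspace M" using V by blast
  have UV: "openin M (U \<inter> V)" "p \<in> U \<inter> V" using V assms by auto
  have G: "smooth_map A (U \<inter> V) G" using smooth_map_subset assms(4) by blast
  have "smooth_field A (U \<inter> V) (const_field A p a)" for a
    using smooth_field_subset V(4) by blast
  from tdiff_commutator[OF UV G this[of a] this[of b]] show ?thesis
    by (simp add: lie_bracket_const_field[OF p] const_field_self[OF p] linear_0[OF linear_tdiff[OF G UV]])
qed

text \<open>The normal part of the symmetry of the second coordinate derivatives of
  \<open>f\<close>.\<close>

lemma sff_sym:
  assumes "p \<in> topspace M" shows "sff p v w = sff p w v"
proof -
  obtain V where "coordinate_nbhd p V" using coordinate_nbhd_exists[OF assms] by blast
  from const_field_commute[OF this openin_topspace assms f_smooth] show ?thesis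
    by (metis sff_np)
qed

lemma smooth_map_sff:
  assumes "openin M U" "smooth_field A U X" "smooth_field A U Y"
  shows "smooth_map A U (\<lambda>q. sff q (X q) (Y q))"
proof -
  have sub: "U \<subseteq> topspace M" using assms(1) openin_subset by blast
  have "smooth_map A U (\<lambda>q. np q (tdiff A (\<lambda>q. df q (Y q)) q (X q)))"
    by (intro smooth_map_np smooth_map_tdiff smooth_map_subset[OF f_smooth sub] assms)
  then show ?thesis
    by (rule smooth_map_cong[OF assms(1), rotated]) (simp add: sff_field[OF assms(1) _ assms(3)])
qed

text \<open>The orthonormal basis picked by \<open>SOME\<close> need not vary continuously. By
  \<open>trace_dual_frame\<close> the trace is computed with the coordinate frame and its dual,
  whose coefficients are smooth.\<close>

lemma smooth_map_mean_curvature: "smooth_map A (topspace M) (mean_curvature A g \<epsilon> f)"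
proof (rule smooth_map_local)
  fix p assume p: "p \<in> topspace M"
  obtain V where "coordinate_nbhd p V" using coordinate_nbhd_exists[OF p] by blast
  note V = coordinate_nbhd_props[OF this]
  let ?E = "\<lambda>a q. const_field A p a q"
  let ?u = "\<lambda>a q. df q (?E a q)"
  have ran: "span ((\<lambda>a. ?u a q) ` I) \<subseteq> range (df q)" if "q \<in> V" for q I
    by (rule span_minimal) (use V(3) that linear_df in
        \<open>auto intro!: linear_subspace_image[of "df q" UNIV]\<close>)
  have pos: "ip v v > 0" if "q \<in> V" "v \<in> span ((\<lambda>a. ?u a q) ` I)" "v \<noteq> 0" for q v I
    using ran[OF that(1), of I] V(3) df_tangent[of q] ip_pos[of q v] that by blast
  have indep: "independent ((\<lambda>a. ?u a q) ` Basis)" if "q \<in> V" for q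
    by (rule linear_independent_injective_image[OF V(8)[OF that] independent_Basis])
      (rule inj_on_subset[OF V(9)[OF that] subset_UNIV])
  have ex: "\<exists>c. (\<forall>j\<in>Basis - {i}. smooth_map A V (c j)) \<and> (\<forall>q\<in>V. \<forall>k\<in>Basis - {i}.
      ip (?u i q - (\<Sum>j\<in>Basis - {i}. c j q *\<^sub>R ?u j q)) (?u k q) = 0)" for i
  proof (rule smooth_projection_coefficients[OF V(1) bounded_bilinear_ambient_form])
    show "inj_on (\<lambda>a. ?u a q) (Basis - {i})" if "q \<in> V" for q
      by (rule inj_on_subset[OF V(9)[OF that]]) simp
    show "independent ((\<lambda>a. ?u a q) ` (Basis - {i}))" if "q \<in> V" for q
      by (rule independent_mono[OF indep[OF that]]) auto
    show "ip v v > 0" if "q \<in> V" "v \<in> span ((\<lambda>a. ?u a q) ` (Basis - {i}))" "v \<noteq> 0" for q v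
      using pos[OF that] .
  qed (simp_all add: V(7))
  obtain c where "\<forall>i. (\<forall>j\<in>Basis - {i}. smooth_map A V (c i j)) \<and> (\<forall>q\<in>V. \<forall>k\<in>Basis - {i}.
      ip (?u i q - (\<Sum>j\<in>Basis - {i}. c i j q *\<^sub>R ?u j q)) (?u k q) = 0)"
    using choice[OF allI[OF ex]] by (rule exE)
  note spec[OF this]
  note c = bspec[OF conjunct1[OF this]] bspec[OF bspec[OF conjunct2[OF this]]]
  \<comment> \<open>\<open>r i\<close> is the part of the \<open>i\<close>-th coordinate vector
    orthogonal to the others; divided by its squared length \<open>N i\<close> it is the image under
    \<open>df\<close> of the dual vector \<open>d i\<close>.\<close>
  define r where "r i q = ?u i q - (\<Sum>j\<in>Basis - {i}. c i j q *\<^sub>R ?u j q)" for i q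
  define N where "N i q = ip (r i q) (r i q)" for i q
  define d where "d i q = inverse (N i q) *\<^sub>R (?E i q - (\<Sum>j\<in>Basis - {i}. c i j q *\<^sub>R ?E j q))" for i q
  have r_smooth: "smooth_map A V (r i)" for i
    unfolding r_def using c(1) V(7) by (intro smooth_map_diff smooth_map_sum smooth_map_scaleR V(1)) auto
  have r_nz: "r i q \<noteq> 0" if "i \<in> Basis" "q \<in> V" for i q
  proof
    assume "r i q = 0"
    then have "?u i q = (\<Sum>j\<in>Basis - {i}. c i j q *\<^sub>R ?u j q)" by (simp add: r_def)
    also have "\<dots> \<in> span ((\<lambda>a. ?u a q) ` (Basis - {i}))"
      by (intro span_sum span_scale span_base) auto
    also have "\<dots> \<subseteq> span ((\<lambda>a. ?u a q) ` Basis - {?u i q})"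
      using V(9)[OF that(2)] by (intro span_mono) (auto dest: injD)
    finally show False using indep[OF that(2)] that(1) unfolding dependent_def by blast
  qed
  have N: "N i q > 0" if "i \<in> Basis" "q \<in> V" for i q
    unfolding N_def
  proof (rule pos[OF that(2) _ r_nz[OF that]])
    show "r i q \<in> span ((\<lambda>a. ?u a q) ` Basis)"
      unfolding r_def using that(1) by (intro span_diff span_sum span_scale span_base) auto
  qed
  have df_d: "df q (d i q) = inverse (N i q) *\<^sub>R r i q" if "q \<in> V" for i q
  proof -
    have lin: "linear (df q)" using linear_df V(3) that by blast
    show ?thesis
      by (simp add: d_def r_def linear_cmul[OF lin] linear_diff[OF lin] linear_sum[OF lin])
  qed
  have dual: "g q (d i q) (?E j q) = (if i = j then 1 else 0)" if "i \<in> Basis" "j \<in> Basis" "q \<in> V" for i j q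
  proof -
    have *: "g q (d i q) (?E j q) = inverse (N i q) * ip (r i q) (?u j q)"
      using df_ip[of q "d i q" "?E j q"] V(3) that(3) by (auto simp: df_d ip.scaleR_left)
    have "ip (r i q) (?u i q) = N i q"
    proof -
      have "ip (r i q) (?u i q) = ip (r i q) (r i q + (\<Sum>j\<in>Basis - {i}. c i j q *\<^sub>R ?u j q))"
        by (simp add: r_def)
      also have "\<dots> = N i q + (\<Sum>j\<in>Basis - {i}. c i j q * ip (r i q) (?u j q))"
        by (simp add: N_def ip.add_right ip.sum_right ip.scaleR_right)
      finally show ?thesis using c(2)[OF that(3), of _ i] by (simp add: r_def[symmetric])
    qed
    then show ?thesis
      unfolding * using c(2)[OF that(3), of j i] N[OF that(1,3)] that(2) by (auto simp: r_def[symmetric])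
  qed
  have mean: "mean_curvature A g \<epsilon> f q = (1 / real DIM('d)) *\<^sub>R (\<Sum>i\<in>Basis. inverse (N i q) *\<^sub>R
      (sff q (?E i q) (?E i q) - (\<Sum>j\<in>Basis - {i}. c i j q *\<^sub>R sff q (?E j q) (?E i q))))"
    if q: "q \<in> V" for q
  proof -
    have qt: "q \<in> topspace M" using q V(3) by blast
    note gp = metric_props[OF qt]
    define B where "B = (SOME B. orthonormal_basis (g q) B)"
    have B: "orthonormal_basis (g q) B"
      unfolding B_def by (rule someI_ex[OF orthonormal_basis_exists]) (use gp in auto)
    have "span ((\<lambda>a. ?E a q) ` Basis) = UNIV"
      using V(6)[OF q] by (simp add: linear_span_image[OF V(5)[OF q]] bij_is_surj)
    then have "(\<Sum>b\<in>B. sff q b b) = (\<Sum>i\<in>Basis. sff q (d i q) (?E i q))"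
      by (intro trace_dual_frame[OF B]) (use gp bilinear_sff[OF qt] dual q in auto)
    moreover have lin: "linear (\<lambda>v. sff q v w)" for w
      using bilinear_sff[OF qt] by (simp add: bilinear_def)
    ultimately show ?thesis
      by (simp add: mean_curvature_def B_def[symmetric] d_def linear_cmul[OF lin] linear_diff[OF lin]
          linear_sum[OF lin])
  qed
  have "smooth_map A V (\<lambda>q. (1 / real DIM('d)) *\<^sub>R (\<Sum>i\<in>Basis. inverse (N i q) *\<^sub>R
      (sff q (?E i q) (?E i q) - (\<Sum>j\<in>Basis - {i}. c i j q *\<^sub>R sff q (?E j q) (?E i q)))))"
  proof (intro smooth_map_scaleR smooth_map_sum smooth_map_const smooth_map_diff smooth_map_inverse
      smooth_map_sff c(1) V(1,4))
    show "smooth_map A V (N i)" for i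
      unfolding N_def
      by (rule smooth_map_bilinear[OF bounded_bilinear_ambient_form V(1) r_smooth r_smooth])
    show "N i q \<noteq> 0" if "i \<in> Basis" "q \<in> V" for i q using N[OF that] by simp
  qed auto
  then have "smooth_map A V (mean_curvature A g \<epsilon> f)"
    by (rule smooth_map_cong[OF V(1), rotated]) (simp add: mean)
  with V(1,2) show "\<exists>U'. openin M U' \<and> p \<in> U' \<and> smooth_map A U' (mean_curvature A g \<epsilon> f)" by blast
qed

end

text \<open>By the second equation of \<open>sym\<close> each operator
  \<open>\<lambda>a. C a c\<close> is self-adjoint, so \<open>commuting\<close> says that two of
  them commute. It is kept in this paired form because the Ricci equation delivers it so.\<close>

lemma commuting_symmetric_traceless_zero:
  fixes h :: "'d::euclidean_space \<Rightarrow> 'd \<Rightarrow> real" and C :: "'d \<Rightarrow> 'd \<Rightarrow> 'd"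
  assumes "orthonormal_basis h B" "bilinear h" "\<And>v w. h v w = h w v" "\<And>v. v \<noteq> 0 \<Longrightarrow> h v v > 0"
    and sym: "\<And>a b. C a b = C b a" "\<And>a b w. h (C a b) w = h (C w b) a"
    and commuting: "\<And>a b c d. h (C b c) (C a d) = h (C a c) (C b d)"
    and traceless: "\<And>b. (\<Sum>v\<in>B. h (C v b) v) = 0"
  shows "C a b = 0"
proof -
  have nonneg: "h v v \<ge> 0" for v
    using assms(4)[of v] by (cases "v = 0") (auto simp: bilinear_lzero[OF assms(2)] less_imp_le)
  have "(\<Sum>v\<in>B. h (C a v) (C a v)) = (\<Sum>v\<in>B. h (C v (C a a)) v)"
  proof (rule sum.cong[OF refl])
    fix v
    \<comment> \<open>Commutativity of the operators trades the two mixed products for the squares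
      \<open>C a a\<close> and \<open>C v v\<close>; total symmetry then moves one \<open>v\<close>
      to the other side, which gives a summand of the trace of the operator of
      \<open>C a a\<close>.\<close>
    have "h (C a v) (C a v) = h (C a a) (C v v)" using commuting[of v a a v] sym(1) by metis
    then show "h (C a v) (C a v) = h (C v (C a a)) v"
      using sym assms(3) by metis
  qed
  then have "(\<Sum>v\<in>B. h (C a v) (C a v)) = 0" using traceless by simp
  moreover have "finite B" using assms(1) by (simp add: orthonormal_basis_def)
  ultimately have "h (C a v) (C a v) = 0" if "v \<in> B" for v
    using that nonneg by (simp add: sum_nonneg_eq_0_iff)
  then have zero: "C a v = 0" if "v \<in> B" for v using assms(4) that by (metis less_irrefl)
  have "h (C a b) v = 0" if "v \<in> B" for v
    using sym zero[OF that] bilinear_lzero[OF assms(2)] by metis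
  then show ?thesis
    by (subst orthonormal_basis_expansion[OF assms(1,2), of "C a b"]) simp
qed

section \<open>The complement of the first normal space and the vertical direction\<close>

locale normal_bundle_split = immersed M A g \<epsilon> f
  for M :: "'p topology" and A :: "('p, 'd::euclidean_space) atlas"
    and g :: "'p \<Rightarrow> 'd \<Rightarrow> 'd \<Rightarrow> real" and \<epsilon> :: real and f :: "'p \<Rightarrow> 'e::euclidean_space ambient" +
  fixes T :: "'p \<Rightarrow> 'd" and \<eta> :: "'p \<Rightarrow> 'e ambient" and L :: "'p \<Rightarrow> 'e ambient set" and l :: nat
  assumes eta: "\<forall>p\<in>topspace M. \<eta> p \<in> normal_space_at A \<epsilon> f p \<and> d_dt = tdiff A f p (T p) + \<eta> p"
    and L: "\<forall>p\<in>topspace M. L p = {x + y | x y. x \<in> first_normal_space A \<epsilon> f p \<and> y \<in> span {\<eta> p}}"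
    and subbundle: "normal_subbundle M A \<epsilon> f L l"
begin

interpretation ip: bounded_bilinear ip by (rule bounded_bilinear_ambient_form)

abbreviation N1 :: "'p \<Rightarrow> 'e ambient set" where "N1 \<equiv> first_normal_space A \<epsilon> f"
abbreviation Lperp :: "'p \<Rightarrow> 'e ambient set" where "Lperp \<equiv> normal_complement A \<epsilon> f L"
abbreviation nconn :: "'p \<Rightarrow> 'd \<Rightarrow> ('p \<Rightarrow> 'e ambient) \<Rightarrow> 'e ambient" where
  "nconn \<equiv> normal_connection A \<epsilon> f"
abbreviation ncurv :: "('p \<Rightarrow> 'd) \<Rightarrow> ('p \<Rightarrow> 'd) \<Rightarrow> ('p \<Rightarrow> 'e ambient) \<Rightarrow> 'p \<Rightarrow> 'e ambient" where
  "ncurv \<equiv> normal_curvature A \<epsilon> f"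

section \<open>Splitting the normal bundle along \<open>L\<close>\<close>

lemma L_nor: "p \<in> topspace M \<Longrightarrow> L p \<subseteq> nor p"
  using subbundle by (simp add: normal_subbundle_def)

lemma L_iff: "p \<in> topspace M \<Longrightarrow> z \<in> L p \<longleftrightarrow> (\<exists>x y. z = x + y \<and> x \<in> N1 p \<and> y \<in> span {\<eta> p})"
  using L by simp

lemma N1_L: "p \<in> topspace M \<Longrightarrow> N1 p \<subseteq> L p"
  using L_iff span_zero by (metis add.right_neutral subsetI)

lemma sff_N1: "sff p v w \<in> N1 p"
  unfolding first_normal_space_def by (rule span_base) blast

lemma eta_L: "p \<in> topspace M \<Longrightarrow> \<eta> p \<in> L p"
  unfolding L_iff first_normal_space_def
  by (intro exI[of _ 0] exI[of _ "\<eta> p"] conjI span_zero span_base) simp_all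

lemma Lperp_nor: "w \<in> Lperp p \<Longrightarrow> w \<in> nor p"
  by (simp add: normal_complement_def)

lemma Lperp_L: "w \<in> Lperp p \<Longrightarrow> x \<in> L p \<Longrightarrow> ip w x = 0"
  by (simp add: normal_complement_def)

lemma LperpI:
  assumes "p \<in> topspace M" "w \<in> nor p" "\<And>v v'. ip w (sff p v v') = 0" "ip w (\<eta> p) = 0"
  shows "w \<in> Lperp p"
proof -
  have "ip w x = 0" if "x \<in> N1 p" for x
    using that unfolding first_normal_space_def
    by (induction rule: span_induct_alt) (auto simp: ip.zero_right ip.add_right ip.scaleR_right assms(3))
  moreover have "ip w y = 0" if "y \<in> span {\<eta> p}" for y
    using that assms(4) by (auto simp: span_singleton ip.scaleR_right)
  ultimately have "ip w x = 0" if "x \<in> L p" for x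
    using that unfolding L_iff[OF assms(1)] by (elim exE conjE) (simp add: ip.add_right)
  then show ?thesis
    using assms(2) by (simp add: normal_complement_def)
qed

text \<open>The normal extension of \<open>n\<close> is projected onto a local frame of
  \<open>L\<close>, where the form is positive. The splitting holds on a whole neighbourhood, so its
  parts can be differentiated.\<close>

lemma smooth_splitting:
  assumes "p \<in> topspace M"
  shows "\<exists>U y. openin M U \<and> p \<in> U \<and> smooth_map A U y \<and>
    (\<forall>q\<in>U. y q \<in> L q \<and> np q n - y q \<in> Lperp q)"
proof -
  have "\<exists>U s. openin M U \<and> p \<in> U \<and> (\<forall>i<l. smooth_section A U L (s i)) \<and>
      (\<forall>q\<in>U. inj_on (\<lambda>i::nat. s i q) {..<l} \<and> independent ((\<lambda>i. s i q) ` {..<l}) \<and>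
         L q = span ((\<lambda>i. s i q) ` {..<l}))"
    using subbundle unfolding normal_subbundle_def by (elim conjE) (erule bspec[OF _ assms])
  then obtain U s where U0: "openin M U" "p \<in> U" "\<forall>i<l. smooth_section A U L (s i)"
    "\<forall>q\<in>U. inj_on (\<lambda>i::nat. s i q) {..<l} \<and> independent ((\<lambda>i. s i q) ` {..<l}) \<and>
      L q = span ((\<lambda>i. s i q) ` {..<l})"
    by (elim exE conjE)
  note U = U0(1,2) U0(3)[rule_format] bspec[OF U0(4)]
  have sub: "U \<subseteq> topspace M" using U(1) openin_subset by blast
  have "\<exists>c. (\<forall>i\<in>{..<l}. smooth_map A U (c i)) \<and> (\<forall>q\<in>U. \<forall>j\<in>{..<l}.
      ip (np q n - (\<Sum>i\<in>{..<l}. c i q *\<^sub>R s i q)) (s j q) = 0)"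
  proof (rule smooth_projection_coefficients[OF U(1) bounded_bilinear_ambient_form])
    show "smooth_map A U (\<lambda>q. np q n)"
      by (rule smooth_map_subset[OF smooth_normal_extension sub])
    show "smooth_map A U (s i)" if "i \<in> {..<l}" for i
      using U(3) that by (simp add: smooth_section_def)
    show "ip v v > 0" if "q \<in> U" "v \<in> span ((\<lambda>i. s i q) ` {..<l})" "v \<noteq> 0" for q v
    proof (rule ip_pos)
      show "q \<in> topspace M" using that(1) sub by blast
      then show "ip v (hor (f q)) = 0" using L_nor[of q] U(4)[OF that(1)] that(2) nor_iff by blast
    qed (rule that(3))
  qed (use U(4) in simp_all)
  then obtain c where c: "\<And>i. i < l \<Longrightarrow> smooth_map A U (c i)"
    "\<And>q j. q \<in> U \<Longrightarrow> j < l \<Longrightarrow> ip (np q n - (\<Sum>i<l. c i q *\<^sub>R s i q)) (s j q) = 0"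
    by (auto simp: lessThan_iff)
  define y where "y q = (\<Sum>i<l. c i q *\<^sub>R s i q)" for q
  have "smooth_map A U y"
    unfolding y_def using c(1) U(3)
    by (intro smooth_map_sum smooth_map_scaleR U(1)) (auto simp: smooth_section_def)
  moreover have "y q \<in> L q" "np q n - y q \<in> Lperp q" if "q \<in> U" for q
  proof -
    have Lq: "L q = span ((\<lambda>i. s i q) ` {..<l})" using U(4) that by blast
    have q: "q \<in> topspace M" using sub that by blast
    show "y q \<in> L q" unfolding Lq y_def by (intro span_sum span_scale span_base) auto
    then have "np q n - y q \<in> nor q"
      using L_nor[OF q] np_nor[OF q] subspace_diff[OF subspace_nor] by blast
    moreover have "ip (np q n - y q) x = 0" if "x \<in> L q" for x
      using that unfolding Lq
      by (induction rule: span_induct_alt)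
        (use c(2)[OF \<open>q \<in> U\<close>] in \<open>auto simp: ip.zero_right ip.add_right ip.scaleR_right y_def\<close>)
    ultimately show "np q n - y q \<in> Lperp q" by (simp add: normal_complement_def)
  qed
  ultimately show ?thesis using U(1,2) by blast
qed

lemma L_double_complement:
  assumes "p \<in> topspace M" "w \<in> nor p" "\<And>x. x \<in> Lperp p \<Longrightarrow> ip w x = 0"
  shows "w \<in> L p"
proof -
  obtain y where y: "y \<in> L p" "w - y \<in> Lperp p"
    using smooth_splitting[OF assms(1), of w] np_normal[OF assms(1,2)] by metis
  have "ip (w - y) (w - y) = ip w (w - y) - ip (w - y) y"
    using ambient_form_sym[of \<epsilon> "w - y" y] by (simp add: ip.diff_left)
  also have "\<dots> = 0" using assms(3)[OF y(2)] Lperp_L[OF y(2,1)] by simp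
  finally have "w - y = 0" using ip_self_zero[OF assms(1)] Lperp_nor[OF y(2)] nor_iff by blast
  then show ?thesis using y(1) by simp
qed

text \<open>The section is the complementary part of the normal extension of \<open>w\<close>. At
  \<open>p\<close> the \<open>L\<close> part vanishes, since it pairs to zero with itself.\<close>

lemma Lperp_extension:
  assumes "p \<in> topspace M" "w \<in> Lperp p"
  shows "\<exists>U \<mu>. openin M U \<and> p \<in> U \<and> smooth_section A U Lperp \<mu> \<and> \<mu> p = w"
proof -
  obtain U y where U: "openin M U" "p \<in> U" "smooth_map A U y"
    "\<And>q. q \<in> U \<Longrightarrow> y q \<in> L q \<and> np q w - y q \<in> Lperp q"
    using smooth_splitting[OF assms(1), of w] by blast
  have sub: "U \<subseteq> topspace M" using U(1) openin_subset by blast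
  have wp: "np p w = w" by (rule np_normal[OF assms(1) Lperp_nor[OF assms(2)]])
  have "ip (y p) (y p) = ip w (y p) - ip (w - y p) (y p)" by (simp add: ip.diff_left)
  also have "\<dots> = 0"
    using U(4)[OF U(2)] Lperp_L[OF assms(2)] Lperp_L[of "w - y p" p "y p"] wp by simp
  finally have "y p = 0"
    using ip_self_zero[OF assms(1)] L_nor[OF assms(1)] U(4)[OF U(2)] nor_iff by blast
  moreover have "smooth_section A U Lperp (\<lambda>q. np q w - y q)"
    unfolding smooth_section_def using U
    by (auto intro!: smooth_map_diff smooth_map_subset[OF smooth_normal_extension sub])
  ultimately show ?thesis using U(1,2) wp by force
qed

subsection \<open>Derivatives of sections of the complement\<close>

lemma ip_tdiff_df:
  assumes "openin M U" "p \<in> U" "smooth_map A U \<xi>" "\<And>q. q \<in> U \<Longrightarrow> \<xi> q \<in> nor q"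
  shows "ip (tdiff A \<xi> p v) (df p w) = - ip (sff p v w) (\<xi> p)"
proof -
  have p: "p \<in> topspace M" using assms(1,2) openin_subset by blast
  obtain V where "coordinate_nbhd p V" using coordinate_nbhd_exists[OF p] by blast
  note V = coordinate_nbhd_props[OF this]
  have UV: "openin M (U \<inter> V)" "p \<in> U \<inter> V" using V assms by auto
  have "ip (tdiff A (\<lambda>q. df q (const_field A p w q)) p v) (\<xi> p)
      = - ip (df p (const_field A p w p)) (tdiff A \<xi> p v)"
    by (rule ip_df_derivative[OF UV smooth_field_subset[OF V(4)] smooth_map_subset[OF assms(3)]])
      (use assms(4) in auto)
  then show ?thesis
    using assms(4)[OF assms(2)]
    by (simp add: const_field_self[OF p] sff_np ip_np[OF p] ambient_form_sym[of \<epsilon> "df p w"])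
qed

text \<open>A normal vector orthogonal to \<open>\<eta>\<close> is orthogonal to
  \<open>d_dt\<close>, which is constant and so can be differentiated in place of
  \<open>\<eta>\<close>. Only orthogonality to \<open>\<eta>\<close> is assumed, so the lemma also
  applies to derivatives of sections of the complement, that is, to second derivatives.\<close>

lemma tdiff_horizontal:
  assumes "openin M U" "p \<in> U" "smooth_map A U \<xi>"
    and "\<And>q. q \<in> U \<Longrightarrow> \<xi> q \<in> nor q" "\<And>q. q \<in> U \<Longrightarrow> ip (\<xi> q) (\<eta> q) = 0"
  shows "ip (tdiff A \<xi> p v) (hor (f p)) = 0" "ip (tdiff A \<xi> p v) d_dt = 0"
proof -
  have sub: "U \<subseteq> topspace M" using assms(1) openin_subset by blast
  have "ip (\<xi> q) d_dt = 0" if "q \<in> U" for q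
  proof -
    have d: "d_dt = df q (T q) + \<eta> q" using eta sub that by blast
    show ?thesis
      using assms(4,5)[OF that] by (subst d) (simp add: nor_iff ip.add_right)
  qed
  note vert = this
  have "ip (\<xi> p) (tdiff A (\<lambda>q. d_dt) p v) = - ip (tdiff A \<xi> p v) d_dt"
    by (rule tdiff_ip_zero[OF assms(1-3) smooth_map_const vert])
  then show "ip (tdiff A \<xi> p v) d_dt = 0" by (simp add: tdiff_const ip.zero_right)
  have fU: "smooth_map A U f" by (rule smooth_map_subset[OF f_smooth sub])
  have "ip (\<xi> p) (tdiff A (\<lambda>q. hor (f q)) p v) = - ip (tdiff A \<xi> p v) (hor (f p))"
    by (rule tdiff_ip_zero[OF assms(1-3) smooth_map_hor[OF assms(1) fU]])
      (use assms(4) nor_iff in blast)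
  \<comment> \<open>The derivative of the position vector is the quadric part of
    \<open>df p v\<close>, which differs from \<open>df p v\<close> by a multiple of
    \<open>d_dt\<close>; \<open>\<xi> p\<close> is orthogonal to both.\<close>
  moreover have "ip (\<xi> p) (hor (df p v)) = 0"
  proof -
    have "ip (\<xi> p) (df p v) = ip (\<xi> p) (hor (df p v)) + snd (df p v) * ip (\<xi> p) d_dt"
      by (subst hor_d_dt[of "df p v"]) (simp add: ip.add_right ip.scaleR_right)
    then show ?thesis using vert[OF assms(2)] assms(4)[OF assms(2)] by (simp add: nor_iff)
  qed
  ultimately show "ip (tdiff A \<xi> p v) (hor (f p)) = 0"
    by (simp add: tdiff_hor[OF assms(1,2) fU])
qed

lemma Lperp_section_tdiff:
  assumes "openin M U" "smooth_section A U Lperp \<xi>" "p \<in> U"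
  shows "tdiff A \<xi> p v \<in> nor p" "ip (tdiff A \<xi> p v) (\<eta> p) = 0"
proof -
  have sub: "U \<subseteq> topspace M" using assms(1) openin_subset by blast
  have p: "p \<in> topspace M" using sub assms(3) by blast
  have sm: "smooth_map A U \<xi>" using assms(2) by (simp add: smooth_section_def)
  have Lp: "\<xi> q \<in> Lperp q" if "q \<in> U" for q using assms(2) that by (simp add: smooth_section_def)
  have nor: "\<xi> q \<in> nor q" and eta0: "ip (\<xi> q) (\<eta> q) = 0" if "q \<in> U" for q
    using Lp[OF that] Lperp_nor Lperp_L eta_L sub that by blast+
  note h = tdiff_horizontal[OF assms(1,3) sm nor eta0]
  have df0: "ip (tdiff A \<xi> p v) (df p w) = 0" for w
  proof -
    have "ip (\<xi> p) (sff p v w) = 0"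
      using Lperp_L[OF Lp[OF assms(3)]] N1_L[OF p] sff_N1 by blast
    then show ?thesis
      using ip_tdiff_df[OF assms(1,3) sm nor] ambient_form_sym[of \<epsilon> "\<xi> p"] by simp
  qed
  then show "tdiff A \<xi> p v \<in> nor p" using h by (simp add: nor_iff)
  have "d_dt = df p (T p) + \<eta> p" using eta p by blast
  then have "ip (tdiff A \<xi> p v) (df p (T p) + \<eta> p) = 0" using h(2)[of v] by metis
  then show "ip (tdiff A \<xi> p v) (\<eta> p) = 0" using df0[of "T p"] by (simp add: ip.add_right)
qed

lemma Lperp_section_nconn:
  assumes "openin M U" "smooth_section A U Lperp \<xi>" "p \<in> U"
  shows "nconn p v \<xi> = tdiff A \<xi> p v"
proof -
  have "p \<in> topspace M" using assms openin_subset by blast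
  then show ?thesis
    using Lperp_section_tdiff(1)[OF assms] by (simp add: normal_connection_np np_normal)
qed

lemma nconn_cong:
  assumes "openin M U" "p \<in> U" "\<And>q. q \<in> U \<Longrightarrow> \<xi> q = \<zeta> q" "smooth_map A U \<xi>"
  shows "nconn p v \<xi> = nconn p v \<zeta>"
  by (simp add: normal_connection_np tdiff_cong[OF assms])

lemma ncurv_Lperp:
  assumes "openin M U" "smooth_section A U Lperp \<xi>" "p \<in> U" "smooth_field A U X" "smooth_field A U Y"
  shows "ncurv X Y \<xi> p = 0"
proof -
  have p: "p \<in> topspace M" using assms openin_subset by blast
  have sm: "smooth_map A U \<xi>" using assms(2) by (simp add: smooth_section_def)
  \<comment> \<open>On all of \<open>U\<close> the inner connection is the flat derivative, so only
    the outer projection remains, and it is linear.\<close>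
  have D: "nconn p v (\<lambda>q. nconn q (Y q) \<xi>) = np p (tdiff A (\<lambda>q. tdiff A \<xi> q (Y q)) p v)"
    if "smooth_field A U Y" for Y v
    using nconn_cong[OF assms(1,3) _ smooth_map_tdiff[OF assms(1) sm that],
        of "\<lambda>q. nconn q (Y q) \<xi>" v] Lperp_section_nconn[OF assms(1,2)]
    by (simp add: normal_connection_np[of p])
  show ?thesis
    unfolding normal_curvature_def D[OF assms(4)] D[OF assms(5)]
    unfolding normal_connection_np
    by (simp flip: linear_diff[OF linear_np[OF p]] tdiff_commutator[OF assms(1,3) sm assms(4,5)]
        add: linear_0[OF linear_np[OF p]])
qed

text \<open>\<open>X'\<close> and \<open>Y'\<close> stand for the covariant derivatives of
  \<open>X\<close> and \<open>Y\<close>. Three of the four terms of (i) contain the curvature of a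
  section of the complement and vanish; \<open>z\<close> is the fourth, where the curvature acts on
  a derivative of \<open>\<xi>\<close>.\<close>

lemma curvature_derivative_reduce:
  assumes "openin M U" "smooth_section A U Lperp \<xi>" "p \<in> U" "smooth_field A U X" "smooth_field A U Y"
    "smooth_field A U X'" "smooth_field A U Y'"
  shows "nconn p v (ncurv X Y \<xi>) - ncurv X' Y \<xi> p - ncurv X Y' \<xi> p - z = - z"
proof -
  have p: "p \<in> topspace M" using assms openin_subset by blast
  have "nconn p v (ncurv X Y \<xi>) = nconn p v (\<lambda>q. 0)"
    by (rule nconn_cong[OF assms(1,3) _ smooth_map_const, symmetric])
      (simp add: ncurv_Lperp[OF assms(1,2) _ assms(4,5)])
  also have "\<dots> = 0" by (simp add: normal_connection_np tdiff_const linear_0[OF linear_np[OF p]])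
  finally show ?thesis
    using assms by (simp add: ncurv_Lperp[OF assms(1,2,3)])
qed

section \<open>Parallelism of the complement\<close>

text \<open>Stated with the flat derivative, which on sections of the complement is the normal
  covariant derivative by \<open>Lperp_section_nconn\<close>.\<close>

definition Lperp_parallel :: bool where
  "Lperp_parallel \<longleftrightarrow> (\<forall>U \<xi> p v. openin M U \<and> smooth_section A U Lperp \<xi> \<and> p \<in> U \<longrightarrow>
     tdiff A \<xi> p v \<in> Lperp p)"

definition N1_derivatives_in_L :: bool where
  "N1_derivatives_in_L \<longleftrightarrow> (\<forall>U X \<xi>. openin M U \<and> smooth_field A U X \<and>
     smooth_section A U nor \<xi> \<and> (\<forall>p\<in>U. \<xi> p \<in> N1 p) \<longrightarrow> (\<forall>p\<in>U. nconn p (X p) \<xi> \<in> L p))"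

text \<open>By \<open>L_double_complement\<close> it is enough to pair with each vector
  \<open>x\<close> of the complement. Extending \<open>x\<close> to a section and differentiating
  its vanishing pairing with \<open>\<xi>\<close> moves the derivative onto the extension.\<close>

lemma N1_derivatives_if_parallel:
  assumes Lperp_parallel shows N1_derivatives_in_L
  unfolding N1_derivatives_in_L_def
proof (intro allI impI ballI)
  fix U X \<xi> p
  assume "openin M U \<and> smooth_field A U X \<and> smooth_section A U nor \<xi> \<and> (\<forall>p\<in>U. \<xi> p \<in> N1 p)"
  then have U: "openin M U" "smooth_map A U \<xi>" "\<And>q. q \<in> U \<Longrightarrow> \<xi> q \<in> N1 q"
    by (auto simp: smooth_section_def)
  assume "p \<in> U"
  have sub: "U \<subseteq> topspace M" using U(1) openin_subset by blast
  have p: "p \<in> topspace M" using sub \<open>p \<in> U\<close> by blast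
  show "nconn p (X p) \<xi> \<in> L p"
  proof (rule L_double_complement[OF p])
    show "nconn p (X p) \<xi> \<in> nor p" by (simp add: normal_connection_np np_nor[OF p])
    fix x assume x: "x \<in> Lperp p"
    obtain U' \<mu> where \<mu>: "openin M U'" "p \<in> U'" "smooth_section A U' Lperp \<mu>" "\<mu> p = x"
      using Lperp_extension[OF p x] by blast
    have UU: "openin M (U \<inter> U')" "p \<in> U \<inter> U'" using U \<mu> \<open>p \<in> U\<close> by auto
    have "ip (\<xi> p) (tdiff A \<mu> p (X p)) = - ip (tdiff A \<xi> p (X p)) (\<mu> p)"
    proof (rule tdiff_ip_zero[OF UU])
      show "smooth_map A (U \<inter> U') \<xi>" using smooth_map_subset[OF U(2)] by blast
      show "smooth_map A (U \<inter> U') \<mu>"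
        using \<mu>(3) smooth_map_subset unfolding smooth_section_def by blast
      show "ip (\<xi> q) (\<mu> q) = 0" if q: "q \<in> U \<inter> U'" for q
      proof -
        have "\<xi> q \<in> L q" using U(3) N1_L sub q by blast
        then have "ip (\<mu> q) (\<xi> q) = 0"
          using \<mu>(3) q Lperp_L unfolding smooth_section_def by blast
        then show ?thesis by (simp add: ambient_form_sym[of \<epsilon> "\<xi> q"])
      qed
    qed
    moreover have "tdiff A \<mu> p (X p) \<in> Lperp p"
      using assms \<mu> unfolding Lperp_parallel_def by blast
    then have "ip (tdiff A \<mu> p (X p)) (\<xi> p) = 0"
      using Lperp_L U(3)[OF \<open>p \<in> U\<close>] N1_L[OF p] by blast
    then have "ip (\<xi> p) (tdiff A \<mu> p (X p)) = 0" by (simp add: ambient_form_sym[of \<epsilon> "\<xi> p"])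
    ultimately show "ip (nconn p (X p) \<xi>) x = 0"
      by (simp add: normal_connection_np ip_np[OF p Lperp_nor[OF x]] \<mu>(4))
  qed
qed

text \<open>Values of the second fundamental form on coordinate fields are smooth sections of
  \<open>N1\<close>, and at \<open>p\<close> they span it. Differentiating their vanishing pairings
  with \<open>\<xi>\<close> shows that the derivative of \<open>\<xi>\<close> is orthogonal to each
  of them.\<close>

lemma parallel_if_N1_derivatives:
  assumes N1_derivatives_in_L shows Lperp_parallel
  unfolding Lperp_parallel_def
proof (intro allI impI)
  fix U \<xi> p v assume asm: "openin M U \<and> smooth_section A U Lperp \<xi> \<and> p \<in> U"
  then have U: "openin M U" "smooth_section A U Lperp \<xi>" "p \<in> U" by auto
  have sub: "U \<subseteq> topspace M" using U(1) openin_subset by blast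
  have p: "p \<in> topspace M" using sub U(3) by blast
  show "tdiff A \<xi> p v \<in> Lperp p"
  proof (rule LperpI[OF p Lperp_section_tdiff(1)[OF U] _ Lperp_section_tdiff(2)[OF U]])
    fix a b
    obtain V where "coordinate_nbhd p V" using coordinate_nbhd_exists[OF p] by blast
    note V = coordinate_nbhd_props[OF this]
    have UV: "openin M (U \<inter> V)" "p \<in> U \<inter> V" using V(1,2) U by auto
    have E: "smooth_field A (U \<inter> V) (const_field A p a)" for a
      by (rule smooth_field_subset[OF V(4)]) simp
    define \<zeta> where "\<zeta> q = sff q (const_field A p a q) (const_field A p b q)" for q
    have \<zeta>: "smooth_map A (U \<inter> V) \<zeta>" unfolding \<zeta>_def by (rule smooth_map_sff[OF UV(1) E E])
    have "smooth_section A (U \<inter> V) nor \<zeta>"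
      unfolding smooth_section_def using \<zeta> sub by (auto simp: \<zeta>_def intro: sff_nor)
    then have "\<forall>p'\<in>U \<inter> V. nconn p' (const_field A p v p') \<zeta> \<in> L p'"
      using assms UV(1) E[of v] sff_N1 unfolding N1_derivatives_in_L_def \<zeta>_def by blast
    from bspec[OF this UV(2)] have "nconn p v \<zeta> \<in> L p" by (simp add: const_field_self[OF p])
    moreover have \<xi>p: "\<xi> p \<in> Lperp p" using U by (simp add: smooth_section_def)
    ultimately have "ip (\<xi> p) (nconn p v \<zeta>) = 0" using Lperp_L by blast
    then have "ip (\<xi> p) (tdiff A \<zeta> p v) = 0"
      using ip_np[OF p Lperp_nor[OF \<xi>p]] by (simp add: normal_connection_np ambient_form_sym[of \<epsilon> "\<xi> p"])
    moreover have "ip (\<xi> p) (tdiff A \<zeta> p v) = - ip (tdiff A \<xi> p v) (\<zeta> p)"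
    proof (rule tdiff_ip_zero[OF UV _ \<zeta>])
      show "smooth_map A (U \<inter> V) \<xi>" using U(2) smooth_map_subset unfolding smooth_section_def by blast
      show "ip (\<xi> q) (\<zeta> q) = 0" if "q \<in> U \<inter> V" for q
      proof (rule Lperp_L)
        show "\<xi> q \<in> Lperp q" using U(2) that by (simp add: smooth_section_def)
        show "\<zeta> q \<in> L q" using N1_L[of q] sff_N1 sub that by (auto simp: \<zeta>_def)
      qed
    qed
    ultimately show "ip (tdiff A \<xi> p v) (sff p a b) = 0"
      by (simp add: \<zeta>_def const_field_self[OF p])
  qed
qed

lemma mean_curvature_N1: "mean_curvature A g \<epsilon> f p \<in> N1 p"
  unfolding mean_curvature_def first_normal_space_def
  by (intro span_scale span_sum span_base) blast

text \<open>The mean curvature is itself a section of \<open>N1\<close>; what has to be supplied is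
  its smoothness.\<close>

lemma nconn_mean_curvature_if_N1_derivatives:
  assumes N1_derivatives_in_L "openin M U" "smooth_field A U X" "p \<in> U"
  shows "nconn p (X p) (mean_curvature A g \<epsilon> f) \<in> L p"
proof -
  have sub: "U \<subseteq> topspace M" using assms(2) openin_subset by blast
  have "smooth_section A U nor (mean_curvature A g \<epsilon> f)"
    unfolding smooth_section_def
    using smooth_map_subset[OF smooth_map_mean_curvature sub] mean_curvature_N1 N1_L L_nor sub by blast
  then show ?thesis
    using assms mean_curvature_N1 unfolding N1_derivatives_in_L_def by blast
qed

text \<open>Under parallelism the derivative of a section of the complement is again such a section,
  so \<open>ncurv_Lperp\<close> applies to it.\<close>

lemma ncurv_derivative_if_parallel:
  assumes Lperp_parallel "openin M U" "smooth_section A U Lperp \<xi>" "p \<in> U"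
    "smooth_field A U X" "smooth_field A U Y" "smooth_field A U Z"
  shows "ncurv X Y (\<lambda>q. nconn q (Z q) \<xi>) p = 0"
proof (rule ncurv_Lperp[OF assms(2) _ assms(4-6)])
  have sm: "smooth_map A U \<xi>" using assms(3) by (simp add: smooth_section_def)
  have "smooth_map A U (\<lambda>q. nconn q (Z q) \<xi>)"
    by (rule smooth_map_cong[OF assms(2) _ smooth_map_tdiff[OF assms(2) sm assms(7)]])
      (simp add: Lperp_section_nconn[OF assms(2,3)])
  then show "smooth_section A U Lperp (\<lambda>q. nconn q (Z q) \<xi>)"
    using assms(1-3) unfolding smooth_section_def[of _ _ _ "\<lambda>q. nconn q (Z q) \<xi>"] Lperp_parallel_def
    by (simp add: Lperp_section_nconn[OF assms(2,3)])
qed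

lemma ncurv_cong:
  assumes "openin M U" "p \<in> U" "\<And>q. q \<in> U \<Longrightarrow> \<xi> q = \<zeta> q" "smooth_map A U \<xi>"
    "smooth_field A U X" "smooth_field A U Y"
  shows "ncurv X Y \<xi> p = ncurv X Y \<zeta> p"
proof -
  have "smooth_map A U (\<lambda>q. nconn q (Z q) \<xi>)" if "smooth_field A U Z" for Z
    unfolding normal_connection_np by (intro smooth_map_np smooth_map_tdiff assms(1,4) that)
  then have "nconn p v (\<lambda>q. nconn q (Z q) \<xi>) = nconn p v (\<lambda>q. nconn q (Z q) \<zeta>)"
    if "smooth_field A U Z" for Z v
    using that by (intro nconn_cong[OF assms(1,2)] nconn_cong[OF assms(1) _ assms(3,4)]) auto
  then show ?thesis
    using nconn_cong[OF assms(1-4)] by (simp add: normal_curvature_def assms(5,6))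
qed

text \<open>
  With \<open>\<zeta> b = D\<^sub>b \<xi>\<close> and \<open>Q a b = D\<^sub>a D\<^sub>b \<xi>\<close> in coordinates at \<open>p\<close>, the vector \<open>C' a b\<close> is the image
  of \<open>a\<close> under the shape operator of \<open>\<zeta> b\<close>, and the symmetry of \<open>Q\<close> is the Codazzi equation.
\<close>

lemma parallel_if_conditions:
  assumes curv: "\<And>U X Y Z \<xi> p. openin M U \<Longrightarrow> smooth_field A U X \<Longrightarrow> smooth_field A U Y \<Longrightarrow>
      smooth_field A U Z \<Longrightarrow> smooth_section A U Lperp \<xi> \<Longrightarrow> p \<in> U \<Longrightarrow>
      ncurv X Y (\<lambda>q. nconn q (Z q) \<xi>) p = 0"
    and mean: "\<And>U X p. openin M U \<Longrightarrow> smooth_field A U X \<Longrightarrow> p \<in> U \<Longrightarrow>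
      nconn p (X p) (mean_curvature A g \<epsilon> f) \<in> L p"
  shows Lperp_parallel
  unfolding Lperp_parallel_def
proof (intro allI impI)
  fix U0 \<xi> p e assume asm: "openin M U0 \<and> smooth_section A U0 Lperp \<xi> \<and> p \<in> U0"
  then have "p \<in> topspace M" using openin_subset by blast
  then obtain V where cn: "coordinate_nbhd p V" using coordinate_nbhd_exists by blast
  note V = coordinate_nbhd_props[OF cn]
  define U where "U = U0 \<inter> V"
  have U: "openin M U" "p \<in> U" using asm V(1,2) by (auto simp: U_def)
  have sub: "U \<subseteq> topspace M" using U(1) openin_subset by blast
  have p: "p \<in> topspace M" using sub U(2) by blast
  have \<xi>: "smooth_section A U Lperp \<xi>"
    using asm smooth_map_subset[of U0 \<xi> U] by (auto simp: smooth_section_def U_def)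
  have \<xi>sm: "smooth_map A U \<xi>" and \<xi>Lp: "\<And>q. q \<in> U \<Longrightarrow> \<xi> q \<in> Lperp q"
    using \<xi> by (auto simp: smooth_section_def)
  define E where "E a q = const_field A p a q" for a q
  have E: "smooth_field A U (E a)" for a
    unfolding E_def[abs_def] by (rule smooth_field_subset[OF V(4)]) (simp add: U_def)
  have Ep: "E a p = a" for a by (simp add: E_def const_field_self[OF p])
  define \<zeta> where "\<zeta> b q = tdiff A \<xi> q (E b q)" for b q
  have \<zeta>sm: "smooth_map A U (\<zeta> b)" for b
    unfolding \<zeta>_def by (rule smooth_map_tdiff[OF U(1) \<xi>sm E])
  have \<zeta>nor: "\<zeta> b q \<in> nor q" and \<zeta>eta: "ip (\<zeta> b q) (\<eta> q) = 0" if "q \<in> U" for b q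
    using Lperp_section_tdiff[OF U(1) \<xi> that] by (simp_all add: \<zeta>_def)
  define Q where "Q a b = tdiff A (\<zeta> b) p a" for a b
  have Q_sym: "Q a b = Q b a" for a b
    using const_field_commute[OF cn U \<xi>sm, of b a] by (simp add: Q_def \<zeta>_def[abs_def] E_def)
  \<comment> \<open>\<open>Q a b\<close> has no position component by
    \<open>tdiff_horizontal\<close>, so it splits into a normal and a tangent vector; the minus sign
    makes \<open>C'\<close> the shape operator.\<close>
  have "\<exists>t. Q a b = np p (Q a b) - df p t" for a b
  proof -
    obtain t c where tc: "np p (Q a b) \<in> nor p" "Q a b = np p (Q a b) + df p t + c *\<^sub>R hor (f p)"
      using np_decomposition[OF p] .
    have "ip (Q a b) (hor (f p)) = 0"
      unfolding Q_def by (rule tdiff_horizontal(1)[OF U \<zeta>sm \<zeta>nor \<zeta>eta])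
    moreover have "ip (Q a b) (hor (f p)) = c * \<epsilon>"
      using tc(1) by (subst tc(2))
        (simp add: ip.add_left ip.scaleR_left nor_iff df_tangent[OF p] ip_position[OF p])
    ultimately have "c = 0" using \<epsilon> by auto
    then show ?thesis
      using tc(2) by (intro exI[of _ "- t"]) (simp add: linear_neg[OF linear_df[OF p]])
  qed
  then obtain C' where C': "\<And>a b. Q a b = np p (Q a b) - df p (C' a b)" by metis
  have df_eq: "df p (C' a b) = np p (Q a b) - Q a b" for a b
    using C'[of a b] by (simp add: algebra_simps)
  have g_sff: "g p (C' a b) w = ip (sff p a w) (\<zeta> b p)" for a b w
  proof -
    have "g p (C' a b) w = ip (np p (Q a b)) (df p w) - ip (Q a b) (df p w)"
      by (simp add: df_ip[OF p, symmetric] df_eq ip.diff_left)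
    also have "ip (np p (Q a b)) (df p w) = 0" using np_nor[OF p] nor_iff by blast
    also have "ip (Q a b) (df p w) = - ip (sff p a w) (\<zeta> b p)"
      unfolding Q_def by (rule ip_tdiff_df[OF U \<zeta>sm \<zeta>nor])
    finally show ?thesis by simp
  qed
  have commuting: "g p (C' b c) (C' a d) = g p (C' a c) (C' b d)" for a b c d
  proof -
    \<comment> \<open>\<open>n b\<close> is the normal covariant derivative of
      \<open>\<zeta> c\<close> along \<open>E b\<close>, and \<open>S\<close> collects the second
      flat derivatives of \<open>\<zeta> c\<close>; being symmetric, \<open>S\<close> drops out of
      the curvature.\<close>
    define n where "n b q = np q (tdiff A (\<zeta> c) q (E b q))" for b q
    define S where "S a b = tdiff A (\<lambda>q. tdiff A (\<zeta> c) q (E b q)) p a" for a b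
    have S: "S a b = S b a" for a b
      using const_field_commute[OF cn U \<zeta>sm[of c], of b a] by (simp add: S_def E_def)
    have D2sm: "smooth_map A U (\<lambda>q. tdiff A (\<zeta> c) q (E b q))" for b
      by (rule smooth_map_tdiff[OF U(1) \<zeta>sm E])
    have nsm: "smooth_map A U (n b)" for b
      unfolding n_def by (rule smooth_map_np[OF U(1) D2sm])
    \<comment> \<open>On all of \<open>U\<close>, \<open>n b\<close> and the flat derivative of
      \<open>\<zeta> c\<close> have the same pairing with the normal \<open>\<zeta> d\<close>.
      Differentiating both pairings leaves the tangential difference at \<open>p\<close> paired with
      \<open>Q a d\<close>: the quadratic term of the Ricci equation.\<close>
    have pair: "ip (tdiff A (n b) p a) (\<zeta> d p) = g p (C' b c) (C' a d) + ip (S a b) (\<zeta> d p)" for a b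
    proof -
      have "tdiff A (\<lambda>q. ip (n b q) (\<zeta> d q)) p
          = tdiff A (\<lambda>q. ip (tdiff A (\<zeta> c) q (E b q)) (\<zeta> d q)) p"
        by (rule tdiff_cong[OF U])
          (use sub in \<open>auto simp: n_def ip_np[OF _ \<zeta>nor] intro!: smooth_map_bilinear[OF
            bounded_bilinear_ambient_form U(1) nsm[unfolded n_def] \<zeta>sm]\<close>)
      then have "ip (n b p) (Q a d) + ip (tdiff A (n b) p a) (\<zeta> d p)
          = ip (Q b c) (Q a d) + ip (S a b) (\<zeta> d p)"
        using tdiff_ip[OF U nsm \<zeta>sm, of b d a] tdiff_ip[OF U D2sm \<zeta>sm, of b d a]
        by (simp add: Q_def S_def Ep)
      moreover have "n b p = np p (Q b c)" by (simp add: n_def Q_def Ep)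
      ultimately have "ip (tdiff A (n b) p a) (\<zeta> d p)
          = - ip (df p (C' b c)) (Q a d) + ip (S a b) (\<zeta> d p)"
        by (simp add: df_eq ip.diff_left)
      also have "ip (df p (C' b c)) (Q a d) = - g p (C' b c) (C' a d)"
      proof -
        have "ip (df p (C' b c)) (Q a d)
            = ip (df p (C' b c)) (np p (Q a d)) - ip (df p (C' b c)) (df p (C' a d))"
          by (subst C'[of a d]) (simp add: ip.diff_right)
        moreover have "ip (np p (Q a d)) (df p (C' b c)) = 0" using np_nor[OF p] nor_iff by blast
        ultimately show ?thesis
          by (simp add: df_ip[OF p] ambient_form_sym[of \<epsilon> "df p (C' b c)"])
      qed
      finally show ?thesis by simp
    qed
    \<comment> \<open>Condition (i) concerns the derivative of \<open>\<xi>\<close> along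
      \<open>E c\<close>, which agrees with \<open>\<zeta> c\<close> on \<open>U\<close>.\<close>
    have "ncurv (E a) (E b) (\<zeta> c) p = ncurv (E a) (E b) (\<lambda>q. nconn q (E c q) \<xi>) p"
      by (rule ncurv_cong[OF U _ \<zeta>sm E E]) (simp add: Lperp_section_nconn[OF U(1) \<xi>] \<zeta>_def)
    also have "\<dots> = 0" by (rule curv[OF U(1) E E E \<xi> U(2)])
    finally have "np p (tdiff A (n b) p a) - np p (tdiff A (n a) p b) = 0"
      using lie_bracket_const_field[OF p, of a b]
      by (simp add: normal_curvature_def normal_connection_np n_def[abs_def] Ep E_def[abs_def]
          const_field_self[OF p] linear_0[OF linear_tdiff[OF \<zeta>sm U]] linear_0[OF linear_np[OF p]])
    then have "ip (np p (tdiff A (n b) p a)) (\<zeta> d p) = ip (np p (tdiff A (n a) p b)) (\<zeta> d p)"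
      by simp
    then have "ip (tdiff A (n b) p a) (\<zeta> d p) = ip (tdiff A (n a) p b) (\<zeta> d p)"
      by (simp add: ip_np[OF p \<zeta>nor[OF U(2)]])
    then show ?thesis using S[of a b] by (simp add: pair)
  qed
  note gp = metric_props[OF p]
  define B where "B = (SOME B. orthonormal_basis (g p) B)"
  have B: "orthonormal_basis (g p) B"
    unfolding B_def by (rule someI_ex[OF orthonormal_basis_exists]) (use gp in auto)
  let ?H = "mean_curvature A g \<epsilon> f"
  \<comment> \<open>Differentiating the vanishing pairing of \<open>\<xi>\<close> with the mean
    curvature turns (ii) into orthogonality of the mean curvature to \<open>\<zeta> b p\<close>.
    That pairing is the trace of the shape operator up to the factor
    \<open>1 / DIM('d)\<close>.\<close>
  have traceless: "(\<Sum>v\<in>B. g p (C' v b) v) = 0" for b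
  proof -
    have "ip (\<xi> p) (tdiff A ?H p b) = - ip (tdiff A \<xi> p b) (?H p)"
    proof (rule tdiff_ip_zero[OF U \<xi>sm smooth_map_subset[OF smooth_map_mean_curvature sub]])
      show "ip (\<xi> q) (?H q) = 0" if "q \<in> U" for q
        using Lperp_L[OF \<xi>Lp[OF that]] mean_curvature_N1 N1_L sub that by blast
    qed
    moreover have "ip (\<xi> p) (np p (tdiff A ?H p b)) = 0"
      using Lperp_L[OF \<xi>Lp[OF U(2)]] mean[OF U(1) E[of b] U(2)]
      by (simp add: normal_connection_np Ep)
    then have "ip (\<xi> p) (tdiff A ?H p b) = 0"
      using ip_np[OF p Lperp_nor[OF \<xi>Lp[OF U(2)]]] by (simp add: ambient_form_sym[of \<epsilon> "\<xi> p"])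
    ultimately have "ip (?H p) (\<zeta> b p) = 0"
      by (simp add: \<zeta>_def Ep ambient_form_sym[of \<epsilon> "?H p"])
    then have "(\<Sum>v\<in>B. ip (sff p v v) (\<zeta> b p)) = 0"
      by (simp add: mean_curvature_def B_def[symmetric] ip.scaleR_left ip.sum_left)
    then show ?thesis by (simp add: g_sff)
  qed
  have C'_zero: "C' a b = 0" for a b
  proof (rule commuting_symmetric_traceless_zero[OF B gp _ _ commuting traceless])
    \<comment> \<open>The symmetry of \<open>Q\<close> passes to \<open>C'\<close> through the
      injective \<open>df p\<close>.\<close>
    show "C' a b = C' b a" for a b
    proof -
      have "df p (C' a b) = df p (C' b a)" unfolding df_eq using Q_sym by metis
      then show ?thesis using df_inj[OF p] by (simp add: inj_eq)
    qed
    show "g p (C' a b) w = g p (C' w b) a" for a b w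
      using sff_sym[OF p] by (simp add: g_sff)
  qed
  have "ip (\<zeta> e p) (sff p a w) = 0" for a w
    using g_sff[of a e w] gp(1) by (simp add: C'_zero bilinear_lzero ambient_form_sym[of \<epsilon> "\<zeta> e p"])
  then have "\<zeta> e p \<in> Lperp p" by (intro LperpI p \<zeta>nor \<zeta>eta U(2))
  then show "tdiff A \<xi> p e \<in> Lperp p" by (simp add: \<zeta>_def Ep)
qed

end

theorem theorem7:
  fixes M :: "'p topology"
    and A :: "('p, 'd::euclidean_space) atlas"
    and g :: "'p \<Rightarrow> 'd \<Rightarrow> 'd \<Rightarrow> real"
    and nabla :: "('p \<Rightarrow> 'd) \<Rightarrow> ('p \<Rightarrow> 'd) \<Rightarrow> 'p \<Rightarrow> 'd"
    and \<epsilon> :: real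
    and f :: "'p \<Rightarrow> 'e::euclidean_space ambient"
    and T :: "'p \<Rightarrow> 'd"
    and \<eta> :: "'p \<Rightarrow> 'e ambient"
    and L :: "'p \<Rightarrow> 'e ambient set"
    and l :: nat
  assumes "\<epsilon> \<in> {-1, 1}"
    and "smooth_manifold M A"
    and "riemannian_metric M A g"
    and "levi_civita M A g nabla"
    and "isometric_immersion M A g \<epsilon> f"
    and "\<forall>p\<in>topspace M. \<eta> p \<in> normal_space_at A \<epsilon> f p \<and> d_dt = tdiff A f p (T p) + \<eta> p"
    and "\<forall>p\<in>topspace M. L p = {x + y | x y. x \<in> first_normal_space A \<epsilon> f p \<and> y \<in> span {\<eta> p}}"
    and "normal_subbundle M A \<epsilon> f L l"
    and "l + DIM('d) < DIM('e) + 1"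
  shows
    "(\<forall>U X \<xi>. openin M U \<and> smooth_field A U X \<and>
         smooth_section A U (normal_space_at A \<epsilon> f) \<xi> \<and> (\<forall>p\<in>U. \<xi> p \<in> first_normal_space A \<epsilon> f p) \<longrightarrow>
         (\<forall>p\<in>U. normal_connection A \<epsilon> f p (X p) \<xi> \<in> L p))
     \<longleftrightarrow>
     (\<forall>U X Y Z \<xi>. openin M U \<and> smooth_field A U X \<and> smooth_field A U Y \<and> smooth_field A U Z \<and>
         smooth_section A U (normal_complement A \<epsilon> f L) \<xi> \<longrightarrow>
         (\<forall>p\<in>U.
            normal_connection A \<epsilon> f p (Z p) (normal_curvature A \<epsilon> f X Y \<xi>)
            - normal_curvature A \<epsilon> f (nabla Z X) Y \<xi> p
            - normal_curvature A \<epsilon> f X (nabla Z Y) \<xi> p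
            - normal_curvature A \<epsilon> f X Y (\<lambda>q. normal_connection A \<epsilon> f q (Z q) \<xi>) p = 0)) \<and>
     (\<forall>U X. openin M U \<and> smooth_field A U X \<longrightarrow>
         (\<forall>p\<in>U. normal_connection A \<epsilon> f p (X p) (mean_curvature A g \<epsilon> f) \<in> L p))"
proof -
  interpret normal_bundle_split M A g \<epsilon> f T \<eta> L l
    by unfold_locales (rule assms)+
  \<comment> \<open>\<open>affine_connection\<close> asserts this under joint premises on three
    fields and a function; the zero function fills the place of \<open>h\<close>.\<close>
  have nabla: "smooth_field A U (nabla Z X)"
    if "openin M U" "smooth_field A U Z" "smooth_field A U X" for U Z X
    using assms(4) that smooth_map_const[of U "0 :: real"]
    unfolding levi_civita_def affine_connection_def by blast
  have reduce: "nconn p (Z p) (ncurv X Y \<xi>) - ncurv (nabla Z X) Y \<xi> p - ncurv X (nabla Z Y) \<xi> p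
      - ncurv X Y (\<lambda>q. nconn q (Z q) \<xi>) p = - ncurv X Y (\<lambda>q. nconn q (Z q) \<xi>) p"
    if "openin M U" "smooth_field A U X" "smooth_field A U Y" "smooth_field A U Z"
      "smooth_section A U Lperp \<xi>" "p \<in> U" for U X Y Z \<xi> p
    by (rule curvature_derivative_reduce[OF that(1,5,6,2,3) nabla[OF that(1,4,2)] nabla[OF that(1,4,3)]])
  show ?thesis (is "?lhs \<longleftrightarrow> ?i \<and> ?ii")
  proof
    assume ?lhs
    then have N1: N1_derivatives_in_L unfolding N1_derivatives_in_L_def .
    note par = parallel_if_N1_derivatives[OF N1]
    have ?i
      using reduce ncurv_derivative_if_parallel[OF par] by (metis (no_types, lifting) neg_equal_0_iff_equal)
    moreover have ?ii using nconn_mean_curvature_if_N1_derivatives[OF N1] by blast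
    ultimately show "?i \<and> ?ii" ..
  next
    assume *: "?i \<and> ?ii"
    have Lperp_parallel
    proof (rule parallel_if_conditions)
      fix U X Y Z \<xi> p
      assume a: "openin M U" "smooth_field A U X" "smooth_field A U Y" "smooth_field A U Z"
        "smooth_section A U Lperp \<xi>" "p \<in> U"
      from * have "nconn p (Z p) (ncurv X Y \<xi>) - ncurv (nabla Z X) Y \<xi> p - ncurv X (nabla Z Y) \<xi> p
        - ncurv X Y (\<lambda>q. nconn q (Z q) \<xi>) p = 0"
        using a by blast
      then show "ncurv X Y (\<lambda>q. nconn q (Z q) \<xi>) p = 0" using reduce[OF a] by simp
    next
      fix U X p assume "openin M U" "smooth_field A U X" "p \<in> U"
      with * show "nconn p (X p) (mean_curvature A g \<epsilon> f) \<in> L p" by blast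
    qed
    then have N1_derivatives_in_L by (rule N1_derivatives_if_parallel)
    then show ?lhs unfolding N1_derivatives_in_L_def .
  qed
qed

end
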